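(* Let $G$ be a $3$-connected cubic graph whose canonical decomposition into cyclically $4$-edge-connected cubic graphs contains at most one cyclically odd factor. Then $G$ admits a coherent decycling partition, i.e. a partition $\{A,J\}$ of $V(G)$ such that $G[A]$ is a tree and $J$ is independent or near-independent.
   Context: A cubic graph is $3$-regular; $3$-connected cubic graphs are simple. $\beta(H)=|E(H)|-|V(H)|+1$ for connected $H$; $H$ is cyclically odd if $\beta(H)$ is odd. A set $B\subseteq E(G)$ is cycle-separating if $G-B$ is disconnected with at least two components containing cycles; a connected graph is cyclically $4$-edge-connected if no set of fewer than $4$ edges is cycle-separating. $3$-sum of bridgeless cubic graphs $G_1,G_2$ at root vertices $v_1,v_2$: delete $v_1,v_2$, keep the three dangling edge-ends at each, and identify the dangling edges of $G_1-v_1$ bijectively with those of $G_2-v_2$. Canonical decomposition: if $G$ has a $3$-edge-cut leaving two components $H_1,H_2$ each with more than one vertex, form $\bar H_i$ by attaching the three dangling edges of $H_i$ to a new vertex, so $G$ is a $3$-sum of $\bar H_1,\bar H_2$; repeating on pieces until none has such a cut yields a collection $\{G_1,\dots,G_r\}$ of cyclically $4$-edge-connected cubic graphs (the factors), unique up to isomorphism and order. $G[A]$ denotes the induced subgraph; $J$ is independent if $G[J]$ has no edge and near-independent if $G[J]$ has exactly one edge. *)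

theory Defs
  imports Main
begin

type_synonym 'a graph = "'a set \<times> 'a set set"

definition verts :: "'a graph \<Rightarrow> 'a set" where "verts G = fst G"
definition edges :: "'a graph \<Rightarrow> 'a set set" where "edges G = snd G"

definition wf_graph :: "'a graph \<Rightarrow> bool" where
  "wf_graph G \<longleftrightarrow> finite (verts G) \<and>
     (\<forall>e\<in>edges G. \<exists>u v. e = {u, v} \<and> u \<noteq> v \<and> u \<in> verts G \<and> v \<in> verts G)"

definition adj :: "'a graph \<Rightarrow> 'a \<Rightarrow> 'a \<Rightarrow> bool" where
  "adj G u v \<longleftrightarrow> {u, v} \<in> edges G"

definition degree :: "'a graph \<Rightarrow> 'a \<Rightarrow> nat" where
  "degree G v = card {e \<in> edges G. v \<in> e}"

definition cubic :: "'a graph \<Rightarrow> bool" where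
  "cubic G \<longleftrightarrow> wf_graph G \<and> (\<forall>v\<in>verts G. degree G v = 3)"

definition induced :: "'a graph \<Rightarrow> 'a set \<Rightarrow> 'a graph" where
  "induced G A = (A \<inter> verts G, {e \<in> edges G. e \<subseteq> A})"

definition del_verts :: "'a graph \<Rightarrow> 'a set \<Rightarrow> 'a graph" where
  "del_verts G S = induced G (verts G - S)"

definition del_edges :: "'a graph \<Rightarrow> 'a set set \<Rightarrow> 'a graph" where
  "del_edges G B = (verts G, edges G - B)"

definition connected :: "'a graph \<Rightarrow> bool" where
  "connected G \<longleftrightarrow> verts G \<noteq> {} \<and>
     (\<forall>u\<in>verts G. \<forall>v\<in>verts G. (adj G)\<^sup>*\<^sup>* u v)"

definition is_cycle :: "'a graph \<Rightarrow> 'a list \<Rightarrow> bool" where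
  "is_cycle G c \<longleftrightarrow> length c \<ge> 3 \<and> distinct c \<and> set c \<subseteq> verts G \<and>
     (\<forall>i. Suc i < length c \<longrightarrow> adj G (c ! i) (c ! Suc i)) \<and>
     adj G (last c) (hd c)"

definition has_cycle :: "'a graph \<Rightarrow> bool" where
  "has_cycle G \<longleftrightarrow> (\<exists>c. is_cycle G c)"

definition tree :: "'a graph \<Rightarrow> bool" where
  "tree G \<longleftrightarrow> connected G \<and> \<not> has_cycle G"

definition k_connected :: "nat \<Rightarrow> 'a graph \<Rightarrow> bool" where
  "k_connected k G \<longleftrightarrow> card (verts G) > k \<and>
     (\<forall>S \<subseteq> verts G. card S < k \<longrightarrow> connected (del_verts G S))"

definition components :: "'a graph \<Rightarrow> 'a graph set" where
  "components G = {induced G {u \<in> verts G. (adj G)\<^sup>*\<^sup>* v u} | v. v \<in> verts G}"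

definition cycle_separating :: "'a graph \<Rightarrow> 'a set set \<Rightarrow> bool" where
  "cycle_separating G B \<longleftrightarrow> B \<subseteq> edges G \<and>
     \<not> connected (del_edges G B) \<and>
     (\<exists>C1 \<in> components (del_edges G B). \<exists>C2 \<in> components (del_edges G B).
        C1 \<noteq> C2 \<and> has_cycle C1 \<and> has_cycle C2)"

definition cyclically_4_edge_connected :: "'a graph \<Rightarrow> bool" where
  "cyclically_4_edge_connected G \<longleftrightarrow> connected G \<and>
     (\<forall>B. card B < 4 \<longrightarrow> \<not> cycle_separating G B)"

definition beta :: "'a graph \<Rightarrow> int" where
  "beta H = int (card (edges H)) - int (card (verts H)) + 1"

definition cyclically_odd :: "'a graph \<Rightarrow> bool" where
  "cyclically_odd H \<longleftrightarrow> odd (beta H)"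

definition cut_edges :: "'a graph \<Rightarrow> 'a set \<Rightarrow> 'a set set" where
  "cut_edges G S = {e \<in> edges G. e \<inter> S \<noteq> {} \<and> e \<inter> (verts G - S) \<noteq> {}}"

definition nontrivial_3cut :: "'a graph \<Rightarrow> 'a set \<Rightarrow> bool" where
  "nontrivial_3cut G S \<longleftrightarrow> S \<subseteq> verts G \<and> card (cut_edges G S) = 3 \<and>
     card S > 1 \<and> card (verts G - S) > 1 \<and>
     connected (induced G S) \<and> connected (induced G (verts G - S))"

definition attach :: "'a graph \<Rightarrow> 'a set \<Rightarrow> 'a \<Rightarrow> 'a graph" where
  "attach G S w = (S \<union> {w},
     {e \<in> edges G. e \<subseteq> S} \<union> {{u, w} | u. u \<in> S \<and> (\<exists>v \<in> verts G - S. {u, v} \<in> edges G)})"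

inductive canon_decomp :: "'a graph \<Rightarrow> 'a graph list \<Rightarrow> bool" where
  stop: "(\<nexists>S. nontrivial_3cut G S) \<Longrightarrow> canon_decomp G [G]"
| split: "nontrivial_3cut G S \<Longrightarrow> w1 \<notin> S \<Longrightarrow> w2 \<notin> verts G - S \<Longrightarrow>
          canon_decomp (attach G S w1) F1 \<Longrightarrow>
          canon_decomp (attach G (verts G - S) w2) F2 \<Longrightarrow>
          canon_decomp G (F1 @ F2)"

definition independent :: "'a graph \<Rightarrow> 'a set \<Rightarrow> bool" where
  "independent G J \<longleftrightarrow> edges (induced G J) = {}"

definition near_independent :: "'a graph \<Rightarrow> 'a set \<Rightarrow> bool" where
  "near_independent G J \<longleftrightarrow> card (edges (induced G J)) = 1"

definition coherent_decycling_partition :: "'a graph \<Rightarrow> 'a set \<Rightarrow> 'a set \<Rightarrow> bool" where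
  "coherent_decycling_partition G A J \<longleftrightarrow>
     A \<union> J = verts G \<and> A \<inter> J = {} \<and> tree (induced G A) \<and>
     (independent G J \<or> near_independent G J)"

end

theory Submission
  imports Defs "HOL-Library.Disjoint_Sets"
begin

text \<open>
  A spanning tree \<open>T\<close> whose cotree edges can be grouped into pairs of adjacent edges (a Xuong tree)
  yields a decycling set in a subcubic graph: the common vertices of the pairs are pairwise
  nonadjacent leaves of \<open>T\<close>. By Nebesky's theorem such a tree exists if
  every partition \<open>Q\<close> of the vertex set satisfies \<open>\<Sum>(1 + [\<beta>(P) odd]) \<le> |crossing edges| + 1\<close>,
  the sum ranging over the parts \<open>P\<close> of \<open>Q\<close>. It is proved by deleting adjacent pairs of edges as long
  as the condition survives. Otherwise there is a nontrivial partition with equality; if it has as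
  many parts as possible, all even parts and all odd parts minus any edge have Xuong trees, and
  Rado's theorem assigns to each odd part a crossing edge such that the remaining ones
  form a tree on the parts.

  A cyclically 4-edge-connected cubic graph \<open>G\<close> satisfies the condition after deletion of any one vertex
  if \<open>\<beta>(G)\<close> is even, and of any two adjacent vertices if \<open>\<beta>(G)\<close> is odd. So in the even case every
  vertex lies in some independent decycling set, and this freedom makes it possible to glue the
  partitions along 3-sums as long as at most one factor is odd.
\<close>

section \<open>Uncrossing partitions\<close>

text \<open>Parity decides how much is deleted: the trivial partition \<open>{V}\<close> forces a
  graph satisfying the condition to have even Betti number. Deleting one vertex of a cubic graph
  keeps the parity of the Betti number, deleting both ends of an edge changes it. So an even factor
  allows any single vertex to be prescribed, whereas an odd factor loses an adjacent pair, which
  costs the one edge permitted inside \<open>J\<close>. Gluing along a 3-sum works when exactly one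
  of the two root vertices is deleted. A side without odd factors can be made to contain its root or
  to avoid it, as the other side requires. A side with an odd factor cannot be steered in this way,
  and therefore its choice is made first and the other side answers.\<close>

lemma partition_on_eqI:
  assumes "partition_on A Q" "P \<in> Q" "P' \<in> Q" "x \<in> P" "x \<in> P'"
  shows "P = P'"
  using assms unfolding partition_on_def disjoint_def by blast

lemma partition_on_refine:
  assumes "partition_on A Q" "R \<in> Q" "partition_on R Y"
  shows "partition_on A (Q - {R} \<union> Y)"
proof (rule partition_onI)
  show "\<Union>(Q - {R} \<union> Y) = A" using assms unfolding partition_on_def by blast
  show "{} \<notin> Q - {R} \<union> Y" using assms unfolding partition_on_def by blast
  fix p q assume pq: "p \<in> Q - {R} \<union> Y" "q \<in> Q - {R} \<union> Y" "p \<noteq> q"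
  have dQ: "\<And>a b. a \<in> Q \<Longrightarrow> b \<in> Q \<Longrightarrow> a \<noteq> b \<Longrightarrow> a \<inter> b = {}"
    using assms(1) unfolding partition_on_def disjoint_def by blast
  have dY: "\<And>a b. a \<in> Y \<Longrightarrow> b \<in> Y \<Longrightarrow> a \<noteq> b \<Longrightarrow> a \<inter> b = {}"
    using assms(3) unfolding partition_on_def disjoint_def by blast
  have sub: "\<And>a. a \<in> Y \<Longrightarrow> a \<subseteq> R" using assms(3) unfolding partition_on_def by blast
  have "R \<inter> a = {}" if "a \<in> Q - {R}" for a using dQ[of R a] assms(2) that by blast
  then show "disjnt p q"
    using pq dQ[of p q] dY[of p q] sub[of p] sub[of q] unfolding disjnt_def by blast
qed

lemma partition_on_refine_disjoint:
  assumes "partition_on A Q" "R \<in> Q" "partition_on R Y"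
  shows "(Q - {R}) \<inter> Y = {}"
proof -
  have "P \<subseteq> R" "P \<noteq> {}" if "P \<in> Y" for P
    using assms(3) that unfolding partition_on_def by blast+
  moreover have "P \<inter> R = {}" if "P \<in> Q - {R}" for P
    using partition_on_eqI[OF assms(1) _ assms(2), of P] that by blast
  ultimately show ?thesis by blast
qed

lemma partition_on_finite:
  "finite A \<Longrightarrow> partition_on A Q \<Longrightarrow> finite Q"
  by (metis finite_UnionD partition_onD1)

lemma sum_partition_on_refine:
  fixes f :: "'a set \<Rightarrow> nat"
  assumes "finite A" "partition_on A Q" "R \<in> Q" "partition_on R Y"
  shows "sum f (Q - {R} \<union> Y) + f R = sum f Q + sum f Y"
proof -
  have fin: "finite Q" "finite Y"
    using assms(1,2) partition_on_finite apply blast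
    using assms partition_on_finite[of R Y] finite_subset[of R A] partition_onD1[OF assms(2)] by blast
  have "sum f (Q - {R} \<union> Y) = sum f (Q - {R}) + sum f Y"
    using fin partition_on_refine_disjoint[OF assms(2-4)] by (intro sum.union_disjoint) auto
  moreover have "sum f Q = f R + sum f (Q - {R})"
    using fin assms by (simp add: sum.remove)
  ultimately show ?thesis by simp
qed

lemma card_partition_on_refine:
  assumes "finite A" "partition_on A Q" "R \<in> Q" "partition_on R Y"
  shows "card (Q - {R} \<union> Y) + 1 = card Q + card Y"
  using sum_partition_on_refine[OF assms, of "\<lambda>_. 1"] by simp

text \<open>The map \<open>ends\<close> makes the elements of \<open>X\<close> hyperedges. Two
  instances occur: the edges of a graph themselves, and, after contraction of the parts of a
  partition, each edge with the set of parts that it meets.\<close>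

definition crossing :: "('e \<Rightarrow> 'b set) \<Rightarrow> 'e set \<Rightarrow> 'b set set \<Rightarrow> 'e set" where
  "crossing ends X Q = {x \<in> X. \<forall>P\<in>Q. \<not> ends x \<subseteq> P}"

text \<open>In the application \<open>M\<close> consists of the odd parts of a tight partition. A
  class formed by one odd part alone has weight 2 instead of 1, and this counts the extra
  units.\<close>

definition marked_singletons :: "'b set \<Rightarrow> 'b set set \<Rightarrow> 'b set" where
  "marked_singletons M Q = {c \<in> M. {c} \<in> Q}"

lemma finite_crossing [simp]: "finite X \<Longrightarrow> finite (crossing ends X Q)"
  by (simp add: crossing_def)

lemma finite_marked_singletons [simp]: "finite M \<Longrightarrow> finite (marked_singletons M Q)"
  by (simp add: marked_singletons_def)

text \<open>Instead of the meet and join of two partitions, only the part \<open>R\<close> of \<open>Q1\<close> is cut up along \<open>Q2\<close>,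
  while the parts of \<open>Q2\<close> that meet \<open>R\<close> are merged. This keeps the total number of parts
  exactly, so that no rank computation is needed.\<close>

lemma uncross_partitions:
  fixes K :: "'b set" and ends :: "'e \<Rightarrow> 'b set"
  assumes K: "finite K" and X: "finite X" "\<And>x. x \<in> X \<Longrightarrow> ends x \<noteq> {}"
    and M: "finite M" "M \<subseteq> K" and Q1: "partition_on K Q1" and Q2: "partition_on K Q2"
    and R: "R \<in> Q1" "\<And>c. R \<noteq> {c}"
  defines "Y \<equiv> {R \<inter> P |P. P \<in> Q2 \<and> R \<inter> P \<noteq> {}}"
  obtains Q3 where "partition_on K Q3" "partition_on K (Q1 - {R} \<union> Y)"
    "card (Q1 - {R} \<union> Y) + card Q3 = card Q1 + card Q2"
    "card (crossing ends X (Q1 - {R} \<union> Y)) + card (crossing ends X Q3)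
       \<le> card (crossing ends X Q1) + card (crossing ends X Q2)"
    "card (marked_singletons M Q1) + card (marked_singletons M Q2)
       + card {c \<in> M \<inter> R. {c} \<notin> Q2 \<and> {c} \<in> Y}
      \<le> card (marked_singletons M (Q1 - {R} \<union> Y)) + card (marked_singletons M Q3)"
proof -
  define Z where "Z = {P \<in> Q2. R \<inter> P \<noteq> {}}"
  define U where "U = \<Union>Z"
  define Q3 where "Q3 = insert U (Q2 - Z)"
  define Q where "Q = Q1 - {R} \<union> Y"
  note fin = partition_on_finite[OF K Q1] partition_on_finite[OF K Q2]
  have finZ: "finite Z" using fin unfolding Z_def by simp
  have RK: "R \<subseteq> K" "R \<noteq> {}" using Q1 R unfolding partition_on_def by auto
  have UnQ2: "\<Union>Q2 = K" using Q2 unfolding partition_on_def by auto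
  have dQ2: "\<And>a b x. a \<in> Q2 \<Longrightarrow> b \<in> Q2 \<Longrightarrow> x \<in> a \<Longrightarrow> x \<in> b \<Longrightarrow> a = b"
    by (rule partition_on_eqI[OF Q2])
  have dQ1: "\<And>a b x. a \<in> Q1 \<Longrightarrow> b \<in> Q1 \<Longrightarrow> x \<in> a \<Longrightarrow> x \<in> b \<Longrightarrow> a = b"
    by (rule partition_on_eqI[OF Q1])
  have Y: "partition_on R Y"
  proof (rule partition_onI)
    show "\<Union>Y = R" unfolding Y_def using UnQ2 RK by blast
    show "{} \<notin> Y" unfolding Y_def by blast
    show "disjnt p q" if "p \<in> Y" "q \<in> Y" "p \<noteq> q" for p q
      using that dQ2 unfolding Y_def disjnt_def by blast
  qed
  have RU: "R \<subseteq> U" unfolding U_def Z_def using UnQ2 RK by blast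
  have outU: "P \<inter> U = {}" if "P \<in> Q2 - Z" for P
    using that dQ2 unfolding U_def Z_def by blast
  have pQ: "partition_on K Q" unfolding Q_def by (rule partition_on_refine[OF Q1 R(1) Y])
  have pQ3: "partition_on K Q3"
  proof (rule partition_onI)
    have "Z \<subseteq> Q2" unfolding Z_def by simp
    then show "\<Union>Q3 = K" unfolding Q3_def U_def UnQ2[symmetric] by blast
    show "{} \<notin> Q3" using Q2 RK RU unfolding Q3_def partition_on_def by blast
    show "disjnt p q" if "p \<in> Q3" "q \<in> Q3" "p \<noteq> q" for p q
      using that dQ2[of p q] outU[of p] outU[of q] unfolding Q3_def disjnt_def by blast
  qed
  \<comment> \<open>Cutting \<open>R\<close> replaces one part by as many as \<open>Z\<close> has,
    and merging \<open>Z\<close> does the reverse, so the total number of parts is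
    unchanged.\<close>
  have cY: "card Y = card Z"
  proof -
    have "Y = (\<lambda>P. R \<inter> P) ` Z" unfolding Y_def Z_def by blast
    moreover have "inj_on (\<lambda>P. R \<inter> P) Z" unfolding inj_on_def Z_def using dQ2 by blast
    ultimately show ?thesis by (simp add: card_image)
  qed
  have "U \<notin> Q2 - Z" using outU RU RK by blast
  then have "card Q3 = card (Q2 - Z) + 1" unfolding Q3_def using fin by simp
  moreover have "card (Q2 - Z) + card Z = card Q2"
    using fin finZ by (metis (no_types, lifting) Z_def card_Diff_subset card_mono le_add_diff_inverse2 mem_Collect_eq subsetI)
  moreover have "card Q + 1 = card Q1 + card Y"
    unfolding Q_def by (rule card_partition_on_refine[OF K Q1 R(1) Y])
  ultimately have c1: "card Q + card Q3 = card Q1 + card Q2" using cY by linarith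
  \<comment> \<open>Only these hyperedges can become crossing when \<open>R\<close> is cut, and all
    of them stop crossing when \<open>Z\<close> is merged, because \<open>R\<close> lies in
    \<open>U\<close>.\<close>
  define W where "W = {x \<in> crossing ends X Q2. ends x \<subseteq> R}"
  have W: "W \<subseteq> crossing ends X Q2" "finite W" "crossing ends X Q1 \<inter> W = {}"
    using R X unfolding W_def crossing_def by auto
  have "crossing ends X Q \<subseteq> crossing ends X Q1 \<union> W"
  proof
    fix x assume x: "x \<in> crossing ends X Q"
    show "x \<in> crossing ends X Q1 \<union> W"
    proof (cases "x \<in> crossing ends X Q1")
      case False
      then obtain P where "P \<in> Q1" "ends x \<subseteq> P" using x unfolding crossing_def by blast
      then have "ends x \<subseteq> R" using x unfolding crossing_def Q_def by blast
      moreover have "\<not> ends x \<subseteq> P" if "P \<in> Q2" for P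
      proof
        assume "ends x \<subseteq> P"
        moreover have "ends x \<noteq> {}" using X x unfolding crossing_def by blast
        ultimately have "R \<inter> P \<in> Y" "ends x \<subseteq> R \<inter> P"
          using that \<open>ends x \<subseteq> R\<close> unfolding Y_def by blast+
        then show False using x unfolding crossing_def Q_def by blast
      qed
      ultimately show ?thesis using x unfolding W_def crossing_def by blast
    qed simp
  qed
  then have "card (crossing ends X Q) \<le> card (crossing ends X Q1 \<union> W)"
    using X W by (intro card_mono) auto
  also have "\<dots> \<le> card (crossing ends X Q1) + card W" by (rule card_Un_le)
  finally have d1: "card (crossing ends X Q) \<le> card (crossing ends X Q1) + card W" .
  have "crossing ends X Q3 \<subseteq> crossing ends X Q2 - W"
  proof
    fix x assume x: "x \<in> crossing ends X Q3"
    then have "\<not> ends x \<subseteq> U" "x \<in> X" unfolding crossing_def Q3_def by auto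
    moreover have "\<not> ends x \<subseteq> P" if "P \<in> Q2" for P
      using x that unfolding crossing_def Q3_def U_def by blast
    ultimately show "x \<in> crossing ends X Q2 - W" using RU unfolding crossing_def W_def by blast
  qed
  then have "card (crossing ends X Q3) \<le> card (crossing ends X Q2 - W)"
    using X by (intro card_mono) auto
  also have "\<dots> = card (crossing ends X Q2) - card W"
    using W by (simp add: card_Diff_subset)
  finally have c2: "card (crossing ends X Q) + card (crossing ends X Q3)
       \<le> card (crossing ends X Q1) + card (crossing ends X Q2)"
    using d1 card_mono[OF _ W(1)] X by simp
  \<comment> \<open>These marked singletons are gained beyond those of \<open>Q1\<close> and
    \<open>Q2\<close>. If both partitions attain equality in a rank condition, this surplus has to
    vanish, which is how the estimate is used.\<close>
  define N where "N = {c \<in> M \<inter> R. {c} \<notin> Q2 \<and> {c} \<in> Y}"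
  \<comment> \<open>No marked singleton of \<open>Q1\<close> is destroyed, because \<open>R\<close>
    is not a singleton. Those of \<open>Q2\<close> inside \<open>R\<close> become parts of
    \<open>Y\<close>; those outside \<open>R\<close> are left to \<open>Q3\<close>.\<close>
  have "marked_singletons M Q1 \<union> ((marked_singletons M Q2 \<inter> R) \<union> N) \<subseteq> marked_singletons M Q"
  proof -
    have "{c} \<in> Y" if "{c} \<in> Q2" "c \<in> R" for c
      using that unfolding Y_def by blast
    then show ?thesis using R(2) unfolding marked_singletons_def Q_def N_def by auto
  qed
  then have "card (marked_singletons M Q1 \<union> ((marked_singletons M Q2 \<inter> R) \<union> N)) \<le> card (marked_singletons M Q)"
    using M by (intro card_mono) auto
  moreover have "card (marked_singletons M Q1 \<union> ((marked_singletons M Q2 \<inter> R) \<union> N))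
      = card (marked_singletons M Q1) + card ((marked_singletons M Q2 \<inter> R) \<union> N)"
  proof (rule card_Un_disjoint)
    show "marked_singletons M Q1 \<inter> ((marked_singletons M Q2 \<inter> R) \<union> N) = {}"
      using dQ1[OF R(1)] R(2) unfolding marked_singletons_def N_def by blast
  qed (use M in \<open>auto simp: N_def\<close>)
  moreover have "card ((marked_singletons M Q2 \<inter> R) \<union> N) = card (marked_singletons M Q2 \<inter> R) + card N"
    by (rule card_Un_disjoint) (use M in \<open>auto simp: N_def marked_singletons_def\<close>)
  moreover have "card (marked_singletons M Q2 - R) \<le> card (marked_singletons M Q3)"
    by (rule card_mono) (use M in \<open>auto simp: marked_singletons_def Q3_def Z_def\<close>)
  moreover have "card (marked_singletons M Q2) = card (marked_singletons M Q2 \<inter> R) + card (marked_singletons M Q2 - R)"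
    using card_Int_Diff[of "marked_singletons M Q2" R] M by simp
  ultimately have c3: "card (marked_singletons M Q1) + card (marked_singletons M Q2) + card N
      \<le> card (marked_singletons M Q) + card (marked_singletons M Q3)" by linarith
  show ?thesis
    using that[of Q3] pQ3 pQ c1 c2 c3 unfolding Q_def N_def by blast
qed

text \<open>This is Rado's theorem for the cographic matroid of the hypergraph and the stars of the vertices
  in \<open>M\<close>. An edge for \<open>C\<close> is found in a minimal part \<open>R\<close> containing \<open>C\<close> of a partition
  attaining equality: any edge from \<open>C\<close> inside \<open>R\<close> can be assigned to \<open>C\<close>.\<close>

lemma transversal_with_connected_complement:
  fixes K :: "'b set" and ends :: "'e \<Rightarrow> 'b set"
  assumes K: "finite K" "card K \<ge> 2"
    and X: "finite X" "\<And>x. x \<in> X \<Longrightarrow> ends x \<noteq> {}" "\<And>x. x \<in> X \<Longrightarrow> ends x \<subseteq> K"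
    and M: "M \<subseteq> K"
    and rank: "\<And>Q. partition_on K Q \<Longrightarrow>
      card Q + card (marked_singletons M Q) \<le> card (crossing ends X Q) + 1"
  shows "\<exists>f. inj_on f M \<and> f ` M \<subseteq> X \<and> (\<forall>c\<in>M. c \<in> ends (f c)) \<and>
    (\<forall>Q. partition_on K Q \<longrightarrow> card Q \<le> card (crossing ends (X - f ` M) Q) + 1)"
proof -
  have "finite M" using M K finite_subset by blast
  then show ?thesis using X M rank
  proof (induction M arbitrary: X rule: finite_induct)
    case empty
    then show ?case by (auto simp: marked_singletons_def)
  next
    case (insert C M)
    let ?M = "insert C M"
    define tight where "tight Q \<longleftrightarrow> partition_on K Q \<and>
      card Q + card (marked_singletons ?M Q) = card (crossing ends X Q) + 1" for Q
    have CK: "C \<in> K" "?M \<subseteq> K" "finite ?M" using insert by auto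
    have Kne: "K \<noteq> {c}" for c using K by auto
    define good where "good QR \<longleftrightarrow> (case QR of (Q, R) \<Rightarrow> tight Q \<and> R \<in> Q \<and> C \<in> R \<and> R \<noteq> {C})" for QR
    have "tight {K}"
    proof -
      have pK: "partition_on K {K}" using CK by (intro partition_on_space) auto
      have "crossing ends X {K} = {}" using insert.prems(3) unfolding crossing_def by auto
      then show ?thesis using insert.prems(5)[OF pK] pK unfolding tight_def by simp
    qed
    then have "good ({K}, K)" using CK Kne unfolding good_def by simp
    then obtain QR where QR: "good QR" "\<And>QR'. good QR' \<Longrightarrow> card (snd QR) \<le> card (snd QR')"
      using arg_min_natI[of good _ "\<lambda>p. card (snd p)"] arg_min_nat_le[of good _ "\<lambda>p. card (snd p)"] by metis
    obtain Q R where "QR = (Q, R)" by force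
    with QR(1) have Q: "tight Q" "R \<in> Q" "C \<in> R" "R \<noteq> {C}"
      unfolding good_def by auto
    have Rmin: "\<And>Q' R'. tight Q' \<Longrightarrow> R' \<in> Q' \<Longrightarrow> C \<in> R' \<Longrightarrow> R' \<noteq> {C} \<Longrightarrow> card R \<le> card R'"
      using QR(2)[of "(_, _)"] \<open>QR = (Q, R)\<close> unfolding good_def by simp
    have Rne: "R \<noteq> {c}" for c using Q by auto
    have pQ: "partition_on K Q" using Q unfolding tight_def by simp
    have RK: "R \<subseteq> K" using Q(2) partition_onD1[OF pQ] by blast
    then have "finite R" using K finite_subset by blast
    \<comment> \<open>Splitting \<open>C\<close> off from \<open>R\<close> adds a part and a marked
      singleton. As \<open>Q\<close> attains equality, a new crossing hyperedge must arise; it lies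
      in \<open>R\<close> and contains \<open>C\<close> and something else.\<close>
    obtain e where e: "e \<in> X" "ends e \<subseteq> R" "C \<in> ends e" "ends e \<noteq> {C}"
    proof -
      let ?Q = "Q - {R} \<union> {{C}, R - {C}}"
      have Y: "partition_on R {{C}, R - {C}}"
        using Q by (auto simp: partition_on_def disjoint_def)
      have p: "partition_on K ?Q" by (rule partition_on_refine[OF pQ Q(2) Y])
      have "{C} \<noteq> R - {C}" by auto
      then have c1: "card ?Q = card Q + 1"
        using card_partition_on_refine[OF K(1) pQ Q(2) Y] by simp
      have "C \<notin> marked_singletons ?M Q"
        using partition_on_eqI[OF pQ Q(2), of "{C}" C] Q unfolding marked_singletons_def by auto
      moreover have "Set.insert C (marked_singletons ?M Q) \<subseteq> marked_singletons ?M ?Q"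
        using Rne by (auto simp: marked_singletons_def)
      then have "card (Set.insert C (marked_singletons ?M Q)) \<le> card (marked_singletons ?M ?Q)"
        using CK by (intro card_mono) auto
      ultimately have "card (marked_singletons ?M Q) + 1 \<le> card (marked_singletons ?M ?Q)"
        using CK by simp
      then have "card (crossing ends X Q) < card (crossing ends X ?Q)"
        using insert.prems(5)[OF p] c1 Q(1) unfolding tight_def by linarith
      then have "\<not> crossing ends X ?Q \<subseteq> crossing ends X Q"
        using card_mono[of "crossing ends X Q"] insert.prems(1) by (meson finite_crossing not_le)
      then obtain e where e: "e \<in> crossing ends X ?Q" "e \<notin> crossing ends X Q" by blast
      then have "e \<in> X" "ends e \<subseteq> R" "\<not> ends e \<subseteq> {C}" "\<not> ends e \<subseteq> R - {C}"
        unfolding crossing_def by blast+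
      then show ?thesis using that[of e] by blast
    qed
    \<comment> \<open>The condition is to survive unmarking \<open>C\<close> and deleting
      \<open>e\<close>. A partition violating it afterwards cannot contain \<open>{C}\<close>, must
      be crossed by \<open>e\<close>, and attained equality before.\<close>
    have rank': "card Q' + card (marked_singletons M Q') \<le> card (crossing ends (X - {e}) Q') + 1"
      if Q': "partition_on K Q'" for Q'
    proof (rule ccontr)
      assume "\<not> ?thesis"
      then have viol: "card Q' + card (marked_singletons M Q') \<ge> card (crossing ends (X - {e}) Q') + 2" by simp
      have r: "card Q' + card (marked_singletons ?M Q') \<le> card (crossing ends X Q') + 1"
        by (rule insert.prems(5)[OF Q'])
      have cX: "crossing ends (X - {e}) Q' = crossing ends X Q' - {e}" unfolding crossing_def by auto
      have nC: "{C} \<notin> Q'"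
      proof
        assume "{C} \<in> Q'"
        then have "marked_singletons ?M Q' = Set.insert C (marked_singletons M Q')"
          unfolding marked_singletons_def by auto
        then have "card (marked_singletons ?M Q') = card (marked_singletons M Q') + 1"
          using insert by (simp add: marked_singletons_def)
        moreover have "card (crossing ends X Q') \<le> card (crossing ends X Q' - {e}) + 1"
          by (simp add: card_Diff_singleton_if) arith
        ultimately show False using viol r unfolding cX by linarith
      qed
      then have mm: "marked_singletons ?M Q' = marked_singletons M Q'"
        unfolding marked_singletons_def by auto
      have eX: "e \<in> crossing ends X Q'"
        using viol r unfolding cX mm by (cases "e \<in> crossing ends X Q'") auto
      then have "card (crossing ends X Q' - {e}) + 1 = card (crossing ends X Q')"
        using insert.prems(1) by (metis Suc_eq_plus1 card_Suc_Diff1 finite_crossing)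
      then have tQ': "card Q' + card (marked_singletons ?M Q') = card (crossing ends X Q') + 1"
        using viol r unfolding cX mm by linarith
      define Y where "Y = {R \<inter> P |P. P \<in> Q' \<and> R \<inter> P \<noteq> {}}"
      let ?Q1 = "Q - {R} \<union> Y"
      obtain Q3 where u: "partition_on K Q3" "partition_on K ?Q1"
        "card ?Q1 + card Q3 = card Q + card Q'"
        "card (crossing ends X ?Q1) + card (crossing ends X Q3)
           \<le> card (crossing ends X Q) + card (crossing ends X Q')"
        "card (marked_singletons ?M Q) + card (marked_singletons ?M Q')
           + card {c \<in> ?M \<inter> R. {c} \<notin> Q' \<and> {c} \<in> Y}
          \<le> card (marked_singletons ?M ?Q1) + card (marked_singletons ?M Q3)"
        unfolding Y_def
        by (rule uncross_partitions[OF K(1) insert.prems(1,2) CK(3,2) pQ Q' Q(2) Rne]) auto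
      note u6 = insert.prems(5)[OF u(1)] insert.prems(5)[OF u(2)]
      have tQ: "card Q + card (marked_singletons ?M Q) = card (crossing ends X Q) + 1"
        using Q(1) unfolding tight_def by simp
      \<comment> \<open>Equality for both partitions leaves no room in the uncrossing estimate. The
        surplus is zero, so cutting \<open>R\<close> does not isolate \<open>C\<close>, and
        minimality puts all of \<open>R\<close>, and with it \<open>e\<close>, into one part of
        \<open>Q'\<close>.\<close>
      have "card {c \<in> ?M \<inter> R. {c} \<notin> Q' \<and> {c} \<in> Y} = 0"
        using u(3-5) u6 tQ tQ' by linarith
      then have "{c \<in> ?M \<inter> R. {c} \<notin> Q' \<and> {c} \<in> Y} = {}" using CK(3) by simp
      then have CY: "{C} \<notin> Y" using nC Q(3) by blast
      have t1: "tight ?Q1" using u(2-5) u6 tQ tQ' unfolding tight_def by linarith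
      have "C \<in> \<Union>Q'" using Q' CK unfolding partition_on_def by blast
      then obtain P where P: "P \<in> Q'" "C \<in> P" by blast
      then have RP: "R \<inter> P \<in> Y" "C \<in> R \<inter> P" unfolding Y_def using Q(3) by blast+
      then have "card R \<le> card (R \<inter> P)" using Rmin[OF t1 _ RP(2)] CY by (metis UnCI)
      then have "R \<inter> P = R" using \<open>finite R\<close> by (simp add: card_seteq)
      then show False using eX e(2) P unfolding crossing_def by blast
    qed
    have "finite (X - {e})" "\<And>x. x \<in> X - {e} \<Longrightarrow> ends x \<noteq> {}"
      "\<And>x. x \<in> X - {e} \<Longrightarrow> ends x \<subseteq> K" "M \<subseteq> K" using insert.prems by auto
    from insert.IH[OF this rank'] obtain f where f: "inj_on f M" "f ` M \<subseteq> X - {e}" "\<forall>c\<in>M. c \<in> ends (f c)"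
      "\<And>Q. partition_on K Q \<Longrightarrow> card Q \<le> card (crossing ends (X - {e} - f ` M) Q) + 1" by blast
    define g where "g = f(C := e)"
    have im: "g ` ?M = Set.insert e (f ` M)" unfolding g_def using insert by auto
    then have "X - g ` ?M = X - {e} - f ` M" by auto
    moreover have "inj_on g ?M" using f(1,2) insert(2) unfolding g_def inj_on_def by auto
    moreover have "g ` ?M \<subseteq> X" using im f(2) e by auto
    moreover have "\<forall>c\<in>?M. c \<in> ends (g c)" using f(3) e unfolding g_def by auto
    ultimately show ?case using f(4) by (intro exI[of _ g]) simp
  qed
qed

section \<open>Weighted partitions of a graph\<close>

definition sgraph :: "'a set \<Rightarrow> 'a set set \<Rightarrow> bool" where
  "sgraph V E \<longleftrightarrow> finite V \<and> (\<forall>e\<in>E. e \<subseteq> V \<and> card e = 2)"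

definition within :: "'a set set \<Rightarrow> 'a set \<Rightarrow> 'a set set" where
  "within E S = {e \<in> E. e \<subseteq> S}"

abbreviation cross_edges :: "'a set set \<Rightarrow> 'a set set \<Rightarrow> 'a set set" where
  "cross_edges E Q \<equiv> crossing (\<lambda>e. e) E Q"

text \<open>A vertex set of odd Betti number counts twice, as in Nebesky's formula for the maximum genus.\<close>

definition weight :: "'a set set \<Rightarrow> 'a set \<Rightarrow> nat" where
  "weight E S = (if even (card (within E S) + card S) then 2 else 1)"

definition spread :: "'a set \<Rightarrow> 'a set set \<Rightarrow> bool" where
  "spread V E \<longleftrightarrow> (\<forall>Q. partition_on V Q \<longrightarrow> sum (weight E) Q \<le> card (cross_edges E Q) + 1)"

text \<open>Cuts replace paths: this is what a partition inequality yields for two parts, and it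
  restricts well to parts and contractions. It holds trivially if \<open>V\<close> has at most one
  element.\<close>

definition conn :: "'a set \<Rightarrow> 'a set set \<Rightarrow> bool" where
  "conn V E \<longleftrightarrow> (\<forall>S. S \<subseteq> V \<longrightarrow> S \<noteq> {} \<longrightarrow> S \<noteq> V \<longrightarrow> (\<exists>e\<in>E. e \<inter> S \<noteq> {} \<and> e \<inter> (V - S) \<noteq> {}))"

text \<open>The edge count stands in for acyclicity and also forces \<open>V\<close> to be nonempty.
  Cycles are excluded in \<open>tree_if_spanning_tree\<close>.\<close>

definition spanning_tree :: "'a set \<Rightarrow> 'a set set \<Rightarrow> bool" where
  "spanning_tree V T \<longleftrightarrow> conn V T \<and> card T + 1 = card V"

inductive paired :: "'a set set \<Rightarrow> 'a set \<Rightarrow> bool" where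
  empty: "paired {} {}"
| pair: "paired S J \<Longrightarrow> e \<notin> S \<Longrightarrow> e' \<notin> S \<Longrightarrow> e \<noteq> e' \<Longrightarrow> x \<in> e \<Longrightarrow> x \<in> e' \<Longrightarrow>
    paired (insert e (insert e' S)) (insert x J)"

text \<open>The members of \<open>J\<close> are the common vertices of the paired cotree edges.\<close>

definition xuong :: "'a set \<Rightarrow> 'a set set \<Rightarrow> bool" where
  "xuong V E \<longleftrightarrow> (\<exists>T J. T \<subseteq> E \<and> spanning_tree V T \<and> paired (E - T) J)"

lemma sgraph_finite: "sgraph V E \<Longrightarrow> finite V" "sgraph V E \<Longrightarrow> finite E"
  unfolding sgraph_def by (auto intro: finite_subset[of E "Pow V"])

lemma sgraph_edgeE:
  assumes "sgraph V E" "e \<in> E"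
  obtains u v where "e = {u, v}" "u \<noteq> v" "u \<in> V" "v \<in> V"
  using assms unfolding sgraph_def by (metis card_2_iff insert_subset)

lemma sgraph_edge_nonempty: "sgraph V E \<Longrightarrow> e \<in> E \<Longrightarrow> e \<noteq> {}"
  by (auto elim: sgraph_edgeE)

lemma sgraph_mono: "sgraph V E \<Longrightarrow> F \<subseteq> E \<Longrightarrow> sgraph V F"
  unfolding sgraph_def by auto

lemma sgraph_within: "sgraph V E \<Longrightarrow> S \<subseteq> V \<Longrightarrow> sgraph S (within E S)"
  unfolding sgraph_def within_def by (auto intro: finite_subset)

lemma within_within: "S \<subseteq> P \<Longrightarrow> within (within E P) S = within E S"
  unfolding within_def by auto

lemma weight_within: "S \<subseteq> P \<Longrightarrow> weight (within E P) S = weight E S"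
  by (simp add: weight_def within_within)

lemma within_subset: "within E S \<subseteq> E"
  unfolding within_def by auto

lemma within_whole: "sgraph V E \<Longrightarrow> within E V = E"
  unfolding within_def sgraph_def by auto

lemma weight_pos: "weight E S \<ge> 1" and weight_le: "weight E S \<le> 2"
  unfolding weight_def by auto

lemma finite_within [simp]: "finite E \<Longrightarrow> finite (within E S)"
  by (simp add: within_def)

lemma card_edges_partition:
  assumes "sgraph V E" "partition_on V Q"
  shows "card E = card (cross_edges E Q) + (\<Sum>P\<in>Q. card (within E P))"
proof -
  note fin = sgraph_finite[OF assms(1)]
  have finQ: "finite Q" using fin assms partition_on_finite by blast
  have E: "E = cross_edges E Q \<union> (\<Union>P\<in>Q. within E P)" unfolding crossing_def within_def by auto
  have "card E = card (cross_edges E Q) + card (\<Union>P\<in>Q. within E P)"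
    by (subst E, rule card_Un_disjoint) (use fin finQ in \<open>auto simp: crossing_def within_def\<close>)
  also have "card (\<Union>P\<in>Q. within E P) = (\<Sum>P\<in>Q. card (within E P))"
  proof (rule card_UN_disjoint)
    show "\<forall>i\<in>Q. \<forall>j\<in>Q. i \<noteq> j \<longrightarrow> within E i \<inter> within E j = {}"
    proof (intro ballI impI, rule ccontr)
      fix i j assume ij: "i \<in> Q" "j \<in> Q" "i \<noteq> j" "within E i \<inter> within E j \<noteq> {}"
      then obtain e where "e \<in> E" "e \<subseteq> i" "e \<subseteq> j" unfolding within_def by auto
      then show False using sgraph_edge_nonempty[OF assms(1)] partition_on_eqI[OF assms(2) ij(1,2)] ij(3) by blast
    qed
  qed (use fin finQ in auto)
  finally show ?thesis .
qed

lemma card_partition_on: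
  "finite V \<Longrightarrow> partition_on V Q \<Longrightarrow> card V = (\<Sum>P\<in>Q. card P)"
  by (metis card_Union_disjoint finite_subset partition_onD1 partition_onD2 Sup_upper)

text \<open>Each weight has the parity of edges plus vertices of its part, and only the crossing
  edges are missing from the total. So the gap between the two sides of the partition inequality
  moves in steps of two, and an estimate that is off by one corrects itself.\<close>

lemma defect_parity:
  assumes "sgraph V E" "partition_on V Q"
  shows "even (sum (weight E) Q + card (cross_edges E Q)) \<longleftrightarrow> even (card E + card V)"
proof -
  have finQ: "finite Q" using sgraph_finite[OF assms(1)] assms partition_on_finite by blast
  have "even (sum (weight E) Q) \<longleftrightarrow> even (\<Sum>P\<in>Q. card (within E P) + card P)"
    using finQ by (induction Q rule: finite_induct) (auto simp: weight_def)
  moreover have "card E + card V = card (cross_edges E Q) + (\<Sum>P\<in>Q. card (within E P) + card P)"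
    using card_edges_partition[OF assms] card_partition_on[OF _ assms(2)] sgraph_finite[OF assms(1)]
    by (simp add: sum.distrib)
  ultimately show ?thesis by auto
qed

lemma cross_edges_refine:
  assumes "sgraph V E" "partition_on V Q" "R \<in> Q" "partition_on R Y"
  shows "card (cross_edges E (Q - {R} \<union> Y)) = card (cross_edges E Q) + card (cross_edges (within E R) Y)"
proof -
  have sub: "P \<subseteq> R" if "P \<in> Y" for P using assms(4) that unfolding partition_on_def by auto
  have dis: "P = R" if "P \<in> Q" "e \<subseteq> R" "e \<subseteq> P" "e \<in> E" for P e
    using that sgraph_edge_nonempty[OF assms(1)] partition_on_eqI[OF assms(2) that(1) assms(3)] by blast
  have "cross_edges E (Q - {R} \<union> Y) = cross_edges E Q \<union> cross_edges (within E R) Y"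
  proof (intro subset_antisym subsetI)
    fix e assume "e \<in> cross_edges E (Q - {R} \<union> Y)"
    then show "e \<in> cross_edges E Q \<union> cross_edges (within E R) Y" unfolding crossing_def within_def by blast
  next
    fix e assume "e \<in> cross_edges E Q \<union> cross_edges (within E R) Y"
    then show "e \<in> cross_edges E (Q - {R} \<union> Y)"
    proof
      assume "e \<in> cross_edges E Q"
      then show ?thesis using sub assms(3) unfolding crossing_def by blast
    next
      assume "e \<in> cross_edges (within E R) Y"
      then show ?thesis using dis[of _ e] unfolding crossing_def within_def by blast
    qed
  qed
  moreover have "cross_edges E Q \<inter> cross_edges (within E R) Y = {}"
    using assms(3) unfolding crossing_def within_def by blast
  ultimately show ?thesis
    using sgraph_finite[OF assms(1)] by (simp add: card_Un_disjoint)
qed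

section \<open>Xuong trees\<close>

lemma paired_Un:
  "paired S J \<Longrightarrow> paired S' J' \<Longrightarrow> S \<inter> S' = {} \<Longrightarrow> paired (S \<union> S') (J \<union> J')"
proof (induction rule: paired.induct)
  case (pair S J e e' x)
  then have "paired (insert e (insert e' (S \<union> S'))) (insert x (J \<union> J'))"
    by (intro paired.pair) auto
  then show ?case by simp
qed simp

lemma paired_UN:
  assumes "finite I" "\<And>i. i \<in> I \<Longrightarrow> paired (S i) (J i)"
    "\<And>i j. i \<in> I \<Longrightarrow> j \<in> I \<Longrightarrow> i \<noteq> j \<Longrightarrow> S i \<inter> S j = {}"
  shows "paired (\<Union>i\<in>I. S i) (\<Union>i\<in>I. J i)"
  using assms
proof (induction I rule: finite_induct)
  case empty
  then show ?case by (simp add: paired.empty)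
next
  case (insert i I)
  have "S i \<inter> (\<Union>i\<in>I. S i) = {}" using insert.prems(2)[of i] insert.hyps by blast
  then have "paired (S i \<union> (\<Union>i\<in>I. S i)) (J i \<union> (\<Union>i\<in>I. J i))"
    using insert by (intro paired_Un) auto
  then show ?case by simp
qed

lemma spread_conn:
  assumes "sgraph V E" "spread V E"
  shows "conn V E"
  unfolding conn_def
proof (intro allI impI)
  fix S assume S: "S \<subseteq> V" "S \<noteq> {}" "S \<noteq> V"
  let ?Q = "{S, V - S}"
  have "partition_on V ?Q" using S by (auto simp: partition_on_def disjoint_def)
  then have "sum (weight E) ?Q \<le> card (cross_edges E ?Q) + 1" using assms unfolding spread_def by blast
  moreover have "sum (weight E) ?Q = weight E S + weight E (V - S)" using S by (subst sum.insert) auto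
  ultimately have "card (cross_edges E ?Q) \<noteq> 0"
    using weight_pos[of E S] weight_pos[of E "V - S"] by linarith
  then obtain e where e: "e \<in> cross_edges E ?Q" by (metis card.empty equals0I)
  then show "\<exists>e\<in>E. e \<inter> S \<noteq> {} \<and> e \<inter> (V - S) \<noteq> {}"
  proof -
    have "e \<in> E" "\<not> e \<subseteq> S" "\<not> e \<subseteq> V - S" using e unfolding crossing_def by auto
    moreover have "e \<subseteq> V" using assms(1) \<open>e \<in> E\<close> unfolding sgraph_def by auto
    ultimately show ?thesis by blast
  qed
qed

lemma spread_parity:
  assumes "sgraph V E" "spread V E" "V \<noteq> {}"
  shows "weight E V = 1" "odd (card E + card V)"
proof -
  have p: "partition_on V {V}" using assms(3) by (intro partition_on_space)
  have "cross_edges E {V} = {}" using assms(1) unfolding crossing_def sgraph_def by auto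
  moreover have "weight E V \<le> card (cross_edges E {V}) + 1" using assms(2) p unfolding spread_def by fastforce
  ultimately show w: "weight E V = 1" using weight_pos[of E V] by simp
  then show "odd (card E + card V)"
    using within_whole[OF assms(1)] unfolding weight_def by (auto split: if_splits)
qed

text \<open>A crossing edge is lost without changing any weight, and an edge inside a part affects
  the weight of that part only. Either way the gap worsens by at most one.\<close>

lemma remove_edge_weight_le:
  assumes "sgraph V E" "e \<in> E" "partition_on V Q"
  shows "sum (weight (E - {e})) Q + card (cross_edges E Q)
    \<le> sum (weight E) Q + card (cross_edges (E - {e}) Q) + 1"
proof -
  note fin = sgraph_finite[OF assms(1)]
  have finQ: "finite Q" using fin assms partition_on_finite by blast
  have c: "cross_edges (E - {e}) Q = cross_edges E Q - {e}" unfolding crossing_def by auto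
  have same: "weight (E - {e}) P = weight E P" if "\<not> e \<subseteq> P" for P
  proof -
    have "within (E - {e}) P = within E P" using that unfolding within_def by auto
    then show ?thesis unfolding weight_def by simp
  qed
  show ?thesis
  proof (cases "e \<in> cross_edges E Q")
    case True
    then have "sum (weight (E - {e})) Q = sum (weight E) Q"
      by (intro sum.cong) (auto simp: crossing_def same)
    moreover have "card (cross_edges E Q - {e}) + 1 = card (cross_edges E Q)"
      using True fin by (metis Suc_eq_plus1 card_Suc_Diff1 finite_crossing)
    ultimately show ?thesis using c by simp
  next
    case False
    then obtain P where P: "P \<in> Q" "e \<subseteq> P" using assms unfolding crossing_def by blast
    have "\<not> e \<subseteq> P'" if "P' \<in> Q - {P}" for P'
      using that P sgraph_edge_nonempty[OF assms(1,2)] partition_on_eqI[OF assms(3) P(1), of P'] by blast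
    then have "sum (weight (E - {e})) (Q - {P}) = sum (weight E) (Q - {P})"
      using same by (intro sum.cong) auto
    moreover have "weight (E - {e}) P \<le> weight E P + 1"
      using weight_le[of "E - {e}" P] weight_pos[of E P] by linarith
    ultimately show ?thesis using False c finQ P by (simp add: sum.remove)
  qed
qed

section \<open>Parts of tight partitions\<close>

definition tight :: "'a set \<Rightarrow> 'a set set \<Rightarrow> 'a set set \<Rightarrow> bool" where
  "tight V E Q \<longleftrightarrow> partition_on V Q \<and> sum (weight E) Q = card (cross_edges E Q) + 1"

text \<open>Since \<open>Q\<close> is tight and \<open>P\<close> contributes exactly 1, the
  inequality for the refinement of \<open>Q\<close> by \<open>Y\<close> reduces to the one for
  \<open>Y\<close> in \<open>P\<close>.\<close>

lemma spread_even_part: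
  assumes "sgraph V E" "spread V E" "tight V E Q" "P \<in> Q" "weight E P = 1"
  shows "spread P (within E P)"
  unfolding spread_def
proof (intro allI impI)
  fix Y assume Y: "partition_on P Y"
  have Q: "partition_on V Q" using assms(3) unfolding tight_def by simp
  note fin = sgraph_finite[OF assms(1)]
  have "sum (weight E) (Q - {P} \<union> Y) \<le> card (cross_edges E (Q - {P} \<union> Y)) + 1"
    using partition_on_refine[OF Q assms(4) Y] assms(2) unfolding spread_def by blast
  then have "sum (weight E) Y \<le> card (cross_edges (within E P) Y) + 1"
    using sum_partition_on_refine[OF fin(1) Q assms(4) Y, of "weight E"]
      cross_edges_refine[OF assms(1) Q assms(4) Y] assms(3,5) unfolding tight_def by linarith
  moreover have "sum (weight (within E P)) Y = sum (weight E) Y"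
    using Y by (intro sum.cong) (auto dest: partition_onD1 intro!: weight_within)
  ultimately show "sum (weight (within E P)) Y \<le> card (cross_edges (within E P) Y) + 1" by simp
qed

lemma card_partition_on_gt_1:
  assumes "finite P" "P \<noteq> {}" "partition_on P Y" "Y \<noteq> {P}"
  shows "card Y > 1"
proof -
  have "finite Y" using assms partition_on_finite by blast
  have "Y \<noteq> {}" using assms unfolding partition_on_def by auto
  moreover have "Y = {P}" if "card Y = 1"
    using that assms(3) by (metis card_1_singletonE ccpo_Sup_singleton partition_onD1)
  ultimately show ?thesis using \<open>finite Y\<close> assms(4) by (metis One_nat_def Suc_lessI card_gt_0_iff)
qed

text \<open>Maximality forbids that the refinement by \<open>Y\<close> is tight, and parity makes it
  miss equality by two. One unit pays for the extra weight of \<open>P\<close>; the other is spare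
  and absorbs a deleted edge in \<open>spread_odd_part\<close>.\<close>

lemma odd_part_slack:
  assumes "sgraph V E" "spread V E" "tight V E Q" "P \<in> Q" "weight E P = 2"
    and max: "\<And>Q'. tight V E Q' \<Longrightarrow> card Q' \<le> card Q"
    and Y: "partition_on P Y" "Y \<noteq> {P}"
  shows "sum (weight E) Y \<le> card (cross_edges (within E P) Y)"
proof -
  have Q: "partition_on V Q" using assms(3) unfolding tight_def by simp
  note fin = sgraph_finite[OF assms(1)]
  have PV: "P \<subseteq> V" "P \<noteq> {}" using Q assms(4) unfolding partition_on_def by auto
  then have "finite P" using fin finite_subset by blast
  let ?Q = "Q - {P} \<union> Y"
  have p: "partition_on V ?Q" by (rule partition_on_refine[OF Q assms(4) Y(1)])
  have "card ?Q > card Q"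
    using card_partition_on_gt_1[OF \<open>finite P\<close> PV(2) Y] card_partition_on_refine[OF fin(1) Q assms(4) Y(1)] by linarith
  then have "sum (weight E) ?Q \<noteq> card (cross_edges E ?Q) + 1"
    using max p unfolding tight_def by (metis not_le)
  moreover have "sum (weight E) ?Q \<le> card (cross_edges E ?Q) + 1"
    using p assms(2) unfolding spread_def by blast
  moreover have "odd (sum (weight E) Q + card (cross_edges E Q))"
    using assms(3) unfolding tight_def by simp
  then have "odd (sum (weight E) ?Q + card (cross_edges E ?Q))"
    using defect_parity[OF assms(1) p] defect_parity[OF assms(1) Q] by simp
  ultimately have "sum (weight E) ?Q + 1 \<le> card (cross_edges E ?Q)"
    by (metis Suc_eq_plus1 Suc_leI even_add le_SucE linorder_neqE_nat not_le)
  then show ?thesis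
    using sum_partition_on_refine[OF fin(1) Q assms(4) Y(1), of "weight E"]
      cross_edges_refine[OF assms(1) Q assms(4) Y(1)] assms(3,5) unfolding tight_def by linarith
qed

text \<open>The analogue of factor-criticality: in a tight partition with as many parts as possible,
  every odd part stays spread after deleting an arbitrary one of its edges.\<close>

lemma spread_odd_part:
  assumes "sgraph V E" "spread V E" "tight V E Q" "P \<in> Q" "weight E P = 2"
    and max: "\<And>Q'. tight V E Q' \<Longrightarrow> card Q' \<le> card Q"
    and e: "e \<in> within E P"
  shows "spread P (within E P - {e})"
  unfolding spread_def
proof (intro allI impI)
  fix Y assume Y: "partition_on P Y"
  have Q: "partition_on V Q" using assms(3) unfolding tight_def by simp
  note fin = sgraph_finite[OF assms(1)]
  have PV: "P \<subseteq> V" using Q assms(4) unfolding partition_on_def by auto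
  note sg = sgraph_within[OF assms(1) PV]
  have wY: "sum (weight (within E P)) Y = sum (weight E) Y"
    using Y by (intro sum.cong) (auto dest: partition_onD1 intro!: weight_within)
  show "sum (weight (within E P - {e})) Y \<le> card (cross_edges (within E P - {e}) Y) + 1"
  proof (cases "Y = {P}")
    \<comment> \<open>The trivial partition has no spare unit, but deleting \<open>e\<close> makes
      the Betti number of \<open>P\<close> even, which lowers its weight to 1.\<close>
    case True
    have "within (within E P - {e}) P = within E P - {e}" unfolding within_def by auto
    moreover have "card (within E P - {e}) + 1 = card (within E P)"
      using e fin by (metis Suc_eq_plus1 card_Suc_Diff1 finite_within)
    moreover have "even (card (within E P) + card P)"
      using assms(5) unfolding weight_def by (simp split: if_splits)
    ultimately have "odd (card (within (within E P - {e}) P) + card P)" by presburger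
    then have "weight (within E P - {e}) P = 1" unfolding weight_def by simp
    then show ?thesis using True by simp
  next
    case False
    have "sum (weight E) Y \<le> card (cross_edges (within E P) Y)"
      using odd_part_slack[OF assms(1-5) max Y False] .
    then show ?thesis using remove_edge_weight_le[OF sg e Y] wY by linarith
  qed
qed

text \<open>Grouping the parts of \<open>Q\<close> amounts to merging them in \<open>V\<close>. This
  carries the partition inequality of \<open>V\<close> over to the hypergraph on \<open>Q\<close> in
  which the ends of an edge are the parts that it meets.\<close>

lemma crossing_coarsening:
  assumes "sgraph V E" "partition_on V Q" "partition_on Q QQ"
  shows "partition_on V (Union ` QQ)" "inj_on Union QQ"
    "cross_edges E (Union ` QQ) = crossing (\<lambda>x. {P \<in> Q. x \<inter> P \<noteq> {}}) (cross_edges E Q) QQ"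
proof -
  have dQ: "\<And>a b x. a \<in> Q \<Longrightarrow> b \<in> Q \<Longrightarrow> x \<in> a \<Longrightarrow> x \<in> b \<Longrightarrow> a = b"
    by (rule partition_on_eqI[OF assms(2)])
  have dQQ: "\<And>a b x. a \<in> QQ \<Longrightarrow> b \<in> QQ \<Longrightarrow> x \<in> a \<Longrightarrow> x \<in> b \<Longrightarrow> a = b"
    by (rule partition_on_eqI[OF assms(3)])
  have UQ: "\<Union>Q = V" "{} \<notin> Q" and UQQ: "\<Union>QQ = Q" "{} \<notin> QQ"
    using assms(2,3) unfolding partition_on_def by auto
  have key: "R = R'" if RR: "R \<in> QQ" "R' \<in> QQ" "x \<in> \<Union>R" "x \<in> \<Union>R'" for R R' x
  proof -
    obtain a b where ab: "a \<in> R" "b \<in> R'" "x \<in> a" "x \<in> b" using RR by blast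
    then have "a \<in> Q" "b \<in> Q" using RR UQQ by blast+
    then have "a = b" using ab dQ by blast
    then show ?thesis using ab RR dQQ by blast
  qed
  have ne: "\<Union>R \<noteq> {}" if R: "R \<in> QQ" for R
  proof -
    obtain a where "a \<in> R" using R UQQ by (metis all_not_in_conv)
    then have "a \<noteq> {}" using UQ UQQ R by blast
    then show ?thesis using \<open>a \<in> R\<close> by blast
  qed
  show inj: "inj_on Union QQ"
    by (rule inj_onI) (metis key ne ex_in_conv)
  show "partition_on V (Union ` QQ)"
  proof (rule partition_onI)
    show "\<Union>(Union ` QQ) = V" using UQ UQQ by blast
    show "{} \<notin> Union ` QQ" using ne by (metis imageE)
    fix p q assume "p \<in> Union ` QQ" "q \<in> Union ` QQ" "p \<noteq> q"
    then obtain R R' where "R \<in> QQ" "R' \<in> QQ" "p = \<Union>R" "q = \<Union>R'" "R \<noteq> R'" by blast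
    then show "disjnt p q" unfolding disjnt_def using key by blast
  qed
  have iff: "e \<subseteq> \<Union>R \<longleftrightarrow> {P \<in> Q. e \<inter> P \<noteq> {}} \<subseteq> R" if "e \<in> E" "R \<in> QQ" for e R
  proof
    assume l: "e \<subseteq> \<Union>R"
    show "{P \<in> Q. e \<inter> P \<noteq> {}} \<subseteq> R"
    proof
      fix P assume P: "P \<in> {P \<in> Q. e \<inter> P \<noteq> {}}"
      then obtain x where "x \<in> e" "x \<in> P" by blast
      moreover from l \<open>x \<in> e\<close> obtain a where "a \<in> R" "x \<in> a" by blast
      moreover have "a \<in> Q" using \<open>a \<in> R\<close> that UQQ by blast
      ultimately show "P \<in> R" using dQ P by blast
    qed
  next
    assume r: "{P \<in> Q. e \<inter> P \<noteq> {}} \<subseteq> R"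
    show "e \<subseteq> \<Union>R"
    proof
      fix x assume "x \<in> e"
      then have "x \<in> V" using assms(1) that unfolding sgraph_def by blast
      then obtain P where "P \<in> Q" "x \<in> P" using UQ by blast
      then show "x \<in> \<Union>R" using r \<open>x \<in> e\<close> by blast
    qed
  qed
  have sub: "cross_edges E (Union ` QQ) \<subseteq> cross_edges E Q"
  proof
    fix e assume e: "e \<in> cross_edges E (Union ` QQ)"
    have "\<not> e \<subseteq> P" if P: "P \<in> Q" for P
    proof
      assume "e \<subseteq> P"
      moreover obtain R where "R \<in> QQ" "P \<in> R" using P UQQ by blast
      ultimately have "e \<subseteq> \<Union>R" by blast
      then show False using e \<open>R \<in> QQ\<close> unfolding crossing_def by blast
    qed
    then show "e \<in> cross_edges E Q" using e unfolding crossing_def by blast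
  qed
  show "cross_edges E (Union ` QQ) = crossing (\<lambda>x. {P \<in> Q. x \<inter> P \<noteq> {}}) (cross_edges E Q) QQ"
  proof (rule set_eqI)
    fix e
    have "e \<in> cross_edges E (Union ` QQ) \<longleftrightarrow> e \<in> cross_edges E Q \<and> e \<in> cross_edges E (Union ` QQ)"
      using sub by blast
    also have "\<dots> \<longleftrightarrow> e \<in> cross_edges E Q \<and> (\<forall>R\<in>QQ. \<not> e \<subseteq> \<Union>R)"
      unfolding crossing_def by auto
    also have "\<dots> \<longleftrightarrow> e \<in> cross_edges E Q \<and> (\<forall>R\<in>QQ. \<not> {P \<in> Q. e \<inter> P \<noteq> {}} \<subseteq> R)"
      using iff[of e] unfolding crossing_def by auto
    finally show "e \<in> cross_edges E (Union ` QQ) \<longleftrightarrow>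
      e \<in> crossing (\<lambda>x. {P \<in> Q. x \<inter> P \<noteq> {}}) (cross_edges E Q) QQ"
      unfolding crossing_def[of "\<lambda>x. {P \<in> Q. x \<inter> P \<noteq> {}}"] by blast
  qed
qed

text \<open>The crossing edge assigned to an odd part is paired with an inner edge at its end in
  that part. Such an inner edge exists by \<open>incident\<close>, and the rest of the part has a
  Xuong tree by \<open>odd\<close>. The trees of the parts are joined by the unassigned crossing
  edges.\<close>

lemma xuong_of_parts:
  assumes V: "sgraph V E" and Q: "tight V E Q" "card Q \<ge> 2" and sp: "spread V E"
    and even: "\<And>P. P \<in> Q \<Longrightarrow> weight E P = 1 \<Longrightarrow> xuong P (within E P)"
    and odd: "\<And>P e. P \<in> Q \<Longrightarrow> weight E P = 2 \<Longrightarrow> e \<in> within E P \<Longrightarrow> xuong P (within E P - {e})"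
    and incident: "\<And>P x. P \<in> Q \<Longrightarrow> weight E P = 2 \<Longrightarrow> x \<in> P \<Longrightarrow> \<exists>e\<in>within E P. x \<in> e"
  shows "xuong V E"
proof -
  note fin = sgraph_finite[OF V]
  have pQ: "partition_on V Q" and eqQ: "sum (weight E) Q = card (cross_edges E Q) + 1"
    using Q(1) unfolding tight_def by auto
  have finQ: "finite Q" using partition_on_finite[OF fin(1) pQ] .
  have UQ: "\<Union>Q = V" using pQ unfolding partition_on_def by simp
  define X where "X = cross_edges E Q"
  define M where "M = {P \<in> Q. weight E P = 2}"
  define ends where "ends x = {P \<in> Q. x \<inter> P \<noteq> {}}" for x
  have finX: "finite X" and XE: "X \<subseteq> E" using fin unfolding X_def crossing_def by auto
  have MQ: "M \<subseteq> Q" unfolding M_def by auto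
  have w_eq: "weight E P = 1 + (if P \<in> M then 1 else 0)" if "P \<in> Q" for P
    using that unfolding M_def weight_def by auto
  have "\<exists>f. inj_on f M \<and> f ` M \<subseteq> X \<and> (\<forall>c\<in>M. c \<in> ends (f c)) \<and>
    (\<forall>QQ. partition_on Q QQ \<longrightarrow> card QQ \<le> card (crossing ends (X - f ` M) QQ) + 1)"
  proof (rule transversal_with_connected_complement[OF finQ Q(2) finX])
    show "ends x \<noteq> {}" if "x \<in> X" for x
    proof -
      have "x \<noteq> {}" "x \<subseteq> V" using that XE sgraph_edge_nonempty[OF V] V unfolding sgraph_def by auto
      then show ?thesis using UQ unfolding ends_def by blast
    qed
    show "ends x \<subseteq> Q" for x unfolding ends_def by auto
    show "M \<subseteq> Q" by (rule MQ)
    fix QQ assume QQ: "partition_on Q QQ"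
    note c = crossing_coarsening[OF V pQ QQ]
    have finQQ: "finite QQ" using partition_on_finite[OF finQ QQ] .
    have "card QQ + card (marked_singletons M QQ) = (\<Sum>R\<in>QQ. 1 + (if R \<in> (\<lambda>c. {c}) ` M then 1 else 0))"
    proof -
      have "card (marked_singletons M QQ) = card ((\<lambda>c. {c}) ` marked_singletons M QQ)"
        by (rule card_image[symmetric]) auto
      also have "(\<lambda>c. {c}) ` marked_singletons M QQ = QQ \<inter> (\<lambda>c. {c}) ` M"
        unfolding marked_singletons_def by auto
      also have "card \<dots> = (\<Sum>R\<in>QQ. (if R \<in> (\<lambda>c. {c}) ` M then 1 else 0))"
        using finQQ by (simp add: sum.If_cases)
      finally show ?thesis by (simp only: sum.distrib) simp
    qed
    \<comment> \<open>A class consisting of one odd part has weight 2 and every class has weight at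
      least 1, so the rank condition follows from the inequality for the merged partition.\<close>
    also have "\<dots> \<le> (\<Sum>R\<in>QQ. weight E (\<Union>R))"
    proof (rule sum_mono)
      fix R assume "R \<in> QQ"
      show "1 + (if R \<in> (\<lambda>c. {c}) ` M then 1 else 0) \<le> weight E (\<Union>R)"
        using weight_pos[of E "\<Union>R"] unfolding M_def by auto
    qed
    also have "\<dots> = sum (weight E) (Union ` QQ)" using c(2) by (simp add: sum.reindex)
    also have "\<dots> \<le> card (cross_edges E (Union ` QQ)) + 1" using c(1) sp unfolding spread_def by blast
    also have "cross_edges E (Union ` QQ) = crossing ends X QQ" using c(3) unfolding ends_def X_def .
    finally show "card QQ + card (marked_singletons M QQ) \<le> card (crossing ends X QQ) + 1" .
  qed
  then obtain f where f: "inj_on f M" "f ` M \<subseteq> X" "\<And>c. c \<in> M \<Longrightarrow> c \<in> ends (f c)"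
    and cn: "\<And>QQ. partition_on Q QQ \<Longrightarrow> card QQ \<le> card (crossing ends (X - f ` M) QQ) + 1" by blast
  define g where "g P = (if P \<in> M then {f P} else {})" for P
  have gX: "g P \<subseteq> X" for P using f(2) unfolding g_def by auto
  have Xw: "X \<inter> within E P = {}" if "P \<in> Q" for P using that unfolding X_def crossing_def within_def by auto
  have "\<exists>T J. T \<subseteq> within E P \<and> spanning_tree P T \<and> paired (g P \<union> (within E P - T)) J" if P: "P \<in> Q" for P
  proof (cases "P \<in> M")
    case False
    then have "xuong P (within E P)" using even[OF P] w_eq[OF P] by simp
    then show ?thesis using False unfolding xuong_def g_def by auto
  next
    case True
    then have w: "weight E P = 2" unfolding M_def by simp
    obtain x where x: "x \<in> f P" "x \<in> P" using f(3)[OF True] unfolding ends_def by blast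
    obtain e where e: "e \<in> within E P" "x \<in> e" using incident[OF P w x(2)] by blast
    obtain T J where T: "T \<subseteq> within E P - {e}" "spanning_tree P T" "paired (within E P - {e} - T) J"
      using odd[OF P w e(1)] unfolding xuong_def by blast
    have fP: "f P \<in> X" using f(2) True by blast
    then have "f P \<notin> within E P" using Xw[OF P] by blast
    then have "f P \<noteq> e" using e by auto
    have "paired (insert (f P) (insert e (within E P - {e} - T))) (insert x J)"
      by (rule paired.pair[OF T(3)]) (use \<open>f P \<notin> within E P\<close> \<open>f P \<noteq> e\<close> x e in auto)
    also have "insert (f P) (insert e (within E P - {e} - T)) = g P \<union> (within E P - T)"
      using T(1) e(1) True unfolding g_def by auto
    finally show ?thesis using T by blast
  qed
  then obtain T J where T: "\<And>P. P \<in> Q \<Longrightarrow> T P \<subseteq> within E P" "\<And>P. P \<in> Q \<Longrightarrow> spanning_tree P (T P)"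
    "\<And>P. P \<in> Q \<Longrightarrow> paired (g P \<union> (within E P - T P)) (J P)" by metis
  have wd: "within E P \<inter> within E P' = {}" if "P \<in> Q" "P' \<in> Q" "P \<noteq> P'" for P P'
  proof (rule ccontr)
    assume "within E P \<inter> within E P' \<noteq> {}"
    then obtain e where "e \<in> E" "e \<subseteq> P" "e \<subseteq> P'" unfolding within_def by auto
    then show False using sgraph_edge_nonempty[OF V] partition_on_eqI[OF pQ that(1,2)] that(3) by blast
  qed
  define TT where "TT = (X - f ` M) \<union> (\<Union>P\<in>Q. T P)"
  have TE: "TT \<subseteq> E" using XE T(1) within_subset unfolding TT_def by blast
  have E: "E = X \<union> (\<Union>P\<in>Q. within E P)" unfolding X_def crossing_def within_def by auto
  have gim: "(\<Union>P\<in>Q. g P) = f ` M" using MQ unfolding g_def by auto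
  have XT: "X \<inter> (\<Union>P\<in>Q. T P) = {}" using T(1) Xw by blast
  have "paired (\<Union>P\<in>Q. g P \<union> (within E P - T P)) (\<Union>P\<in>Q. J P)"
  proof (rule paired_UN[OF finQ])
    show "paired (g P \<union> (within E P - T P)) (J P)" if "P \<in> Q" for P by (rule T(3)[OF that])
    fix P P' assume P: "P \<in> Q" "P' \<in> Q" "P \<noteq> P'"
    have "g P \<inter> g P' = {}" using f(1) P(3) unfolding g_def inj_on_def by auto
    then show "(g P \<union> (within E P - T P)) \<inter> (g P' \<union> (within E P' - T P')) = {}"
      using wd[OF P] gX[of P] gX[of P'] Xw[OF P(1)] Xw[OF P(2)] by blast
  qed
  moreover have "E - TT = (\<Union>P\<in>Q. g P \<union> (within E P - T P))"
  proof -
    have a: "(\<Union>P\<in>Q. g P \<union> (within E P - T P)) = f ` M \<union> (\<Union>P\<in>Q. within E P - T P)"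
      unfolding gim[symmetric] by blast
    have b: "(\<Union>P\<in>Q. within E P) - (\<Union>P\<in>Q. T P) = (\<Union>P\<in>Q. within E P - T P)"
    proof (intro subset_antisym subsetI)
      fix e assume "e \<in> (\<Union>P\<in>Q. within E P - T P)"
      then obtain P where P: "P \<in> Q" "e \<in> within E P" "e \<notin> T P" by blast
      have "e \<notin> T P'" if "P' \<in> Q" for P' using wd[OF P(1) that] P T(1)[OF that] by blast
      then show "e \<in> (\<Union>P\<in>Q. within E P) - (\<Union>P\<in>Q. T P)" using P by blast
    qed blast
    have "(\<Union>P\<in>Q. within E P) \<inter> X = {}" using Xw by blast
    then have "E - TT = f ` M \<union> ((\<Union>P\<in>Q. within E P) - (\<Union>P\<in>Q. T P))"
      using f(2) XT unfolding TT_def by (subst E) blast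
    then show ?thesis using a b by simp
  qed
  ultimately have pr: "paired (E - TT) (\<Union>P\<in>Q. J P)" by simp
  have "conn V TT" unfolding conn_def
  proof (intro allI impI)
    fix S assume S: "S \<subseteq> V" "S \<noteq> {}" "S \<noteq> V"
    show "\<exists>e\<in>TT. e \<inter> S \<noteq> {} \<and> e \<inter> (V - S) \<noteq> {}"
    proof (cases "\<exists>P\<in>Q. S \<inter> P \<noteq> {} \<and> S \<inter> P \<noteq> P")
      case True
      then obtain P where P: "P \<in> Q" "S \<inter> P \<noteq> {}" "S \<inter> P \<noteq> P" by blast
      then obtain e where "e \<in> T P" "e \<inter> (S \<inter> P) \<noteq> {}" "e \<inter> (P - S \<inter> P) \<noteq> {}"
        using T(2)[OF P(1)] unfolding spanning_tree_def conn_def by (metis Int_lower2)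
      moreover have "P \<subseteq> V" using UQ P by blast
      ultimately show ?thesis using P(1) unfolding TT_def by blast
    next
      case False
      \<comment> \<open>Now \<open>S\<close> is a union of parts, so the two classes of parts inside
        and outside \<open>S\<close> are separated in the contraction, and \<open>cn\<close>
        provides an unassigned edge between them.\<close>
      then have sep: "\<And>P. P \<in> Q \<Longrightarrow> P \<subseteq> S \<or> P \<inter> S = {}" by blast
      let ?A = "{P \<in> Q. P \<subseteq> S}" and ?B = "{P \<in> Q. P \<inter> S = {}}"
      have ne: "{} \<notin> Q" using pQ unfolding partition_on_def by blast
      have dA: "?A \<inter> ?B = {}" using ne by (auto simp: Int_absorb2)
      obtain x y where xy: "x \<in> S" "y \<in> V - S" using S by blast
      then obtain P P' where PP: "P \<in> Q" "x \<in> P" "P' \<in> Q" "y \<in> P'" using S UQ by blast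
      have A: "P \<in> ?A" using PP xy sep[of P] by blast
      have B: "P' \<in> ?B" using PP xy sep[of P'] by blast
      have "?A \<noteq> ?B" using dA A by blast
      have pAB: "partition_on Q {?A, ?B}"
      proof (rule partition_onI)
        have "?A \<union> ?B = Q" using sep by auto
        then show "\<Union>{?A, ?B} = Q" by simp
        show "{} \<notin> {?A, ?B}" using A B by blast
        show "disjnt p q" if "p \<in> {?A, ?B}" "q \<in> {?A, ?B}" "p \<noteq> q" for p q
          proof -
          have "p = ?A \<and> q = ?B \<or> p = ?B \<and> q = ?A" using that by blast
          then show ?thesis using dA Int_commute[of ?A ?B] unfolding disjnt_def by (elim disjE conjE) simp_all
        qed
      qed
      then have "card {?A, ?B} \<le> card (crossing ends (X - f ` M) {?A, ?B}) + 1" by (rule cn)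
      then have "card (crossing ends (X - f ` M) {?A, ?B}) \<noteq> 0" using \<open>?A \<noteq> ?B\<close> by simp
      then have "crossing ends (X - f ` M) {?A, ?B} \<noteq> {}" by (auto simp only: card.empty)
      then obtain e where e: "e \<in> crossing ends (X - f ` M) {?A, ?B}" by (meson ex_in_conv)
      then have "\<not> ends e \<subseteq> ?A" "\<not> ends e \<subseteq> ?B" and eX: "e \<in> X - f ` M" unfolding crossing_def by auto
      then obtain P1 P2 where P12: "P1 \<in> ends e" "P1 \<notin> ?A" "P2 \<in> ends e" "P2 \<notin> ?B" by blast
      then have "P1 \<in> Q" "P2 \<in> Q" "e \<inter> P1 \<noteq> {}" "e \<inter> P2 \<noteq> {}" unfolding ends_def by auto
      moreover have "P1 \<inter> S = {}" "P2 \<subseteq> S" using sep[of P1] sep[of P2] P12 \<open>P1 \<in> Q\<close> \<open>P2 \<in> Q\<close> by auto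
      moreover have "P1 \<subseteq> V" using UQ \<open>P1 \<in> Q\<close> by blast
      ultimately have "e \<inter> S \<noteq> {} \<and> e \<inter> (V - S) \<noteq> {}" by blast
      then show ?thesis using eX unfolding TT_def by blast
    qed
  qed
  moreover have "card TT + 1 = card V"
  proof -
    have finT: "finite (T P)" if "P \<in> Q" for P using T(1)[OF that] fin finite_subset finite_within by metis
    have "card TT = card (X - f ` M) + card (\<Union>P\<in>Q. T P)"
      unfolding TT_def by (rule card_Un_disjoint) (use finX finQ finT XT in auto)
    moreover have "card (\<Union>P\<in>Q. T P) = (\<Sum>P\<in>Q. card (T P))"
    proof (rule card_UN_disjoint[OF finQ])
      show "\<forall>i\<in>Q. finite (T i)" using finT by blast
      show "\<forall>i\<in>Q. \<forall>j\<in>Q. i \<noteq> j \<longrightarrow> T i \<inter> T j = {}"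
      proof (intro ballI impI)
        fix i j assume ij: "i \<in> Q" "j \<in> Q" "i \<noteq> j"
        show "T i \<inter> T j = {}" using wd[OF ij] T(1)[OF ij(1)] T(1)[OF ij(2)] by blast
      qed
    qed
    moreover have "card V = (\<Sum>P\<in>Q. card (T P)) + card Q"
    proof -
      have "card V = (\<Sum>P\<in>Q. card P)" by (rule card_partition_on[OF fin(1) pQ])
      also have "\<dots> = (\<Sum>P\<in>Q. card (T P) + 1)"
        using T(2) unfolding spanning_tree_def by (intro sum.cong) auto
      also have "\<dots> = (\<Sum>P\<in>Q. card (T P)) + card Q" by (simp only: sum.distrib) simp
      finally show ?thesis .
    qed
    \<comment> \<open>Tightness is what leaves exactly \<open>card Q - 1\<close> crossing edges once
      every odd part has received one.\<close>
    moreover have "card X + 1 = card Q + card M"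
    proof -
      have "card X + 1 = (\<Sum>P\<in>Q. 1 + (if P \<in> M then 1 else 0))"
        using eqQ w_eq unfolding X_def by (simp cong: sum.cong)
      also have "\<dots> = card Q + card (Q \<inter> M)" using finQ by (simp only: sum.distrib) (simp add: sum.If_cases)
      finally show ?thesis using MQ by (simp add: Int_absorb1)
    qed
    moreover have "card (f ` M) = card M" by (rule card_image[OF f(1)])
    moreover have "card (X - f ` M) + card (f ` M) = card X"
      using f(2) finX by (metis card_Diff_subset card_mono finite_subset le_add_diff_inverse2)
    ultimately show ?thesis by linarith
  qed
  ultimately show ?thesis using TE pr unfolding xuong_def spanning_tree_def by blast
qed

theorem xuong_if_spread:
  assumes "sgraph V E" "V \<noteq> {}" "spread V E"
  shows "xuong V E"
  using assms
proof (induction "card V + card E" arbitrary: V E rule: less_induct)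
  case less
  note V = less.prems(1) and sp = less.prems(3)
  note fin = sgraph_finite[OF V]
  note par = spread_parity[OF V sp less.prems(2)]
  show ?case
  proof (cases "\<exists>e\<in>E. \<exists>e'\<in>E. e \<noteq> e' \<and> e \<inter> e' \<noteq> {}")
    \<comment> \<open>Without adjacent edges, connectedness leaves only a single vertex or a single
      edge.\<close>
    case False
    have "paired {} {}" by (rule paired.empty)
    have cn: "conn V E" by (rule spread_conn[OF V sp])
    have "card E + 1 = card V"
    proof (cases "E = {}")
      case True
      obtain v where v: "v \<in> V" using less.prems by blast
      then have "V = {v}" using cn True unfolding conn_def by (metis empty_iff empty_subsetI insert_not_empty insert_subset)
      then show ?thesis using True by simp
    next
      case ne: False
      then obtain e where e: "e \<in> E" by blast
      have c2: "card e = 2" "e \<subseteq> V" using V e unfolding sgraph_def by auto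
      have "e = V"
      proof (rule ccontr)
        assume "e \<noteq> V"
        then obtain e' where "e' \<in> E" "e' \<inter> e \<noteq> {}" "e' \<inter> (V - e) \<noteq> {}"
          using cn c2 sgraph_edge_nonempty[OF V e] unfolding conn_def by metis
        then show False using False e by blast
      qed
      moreover have "E = {e}"
      proof -
        have "e' = e" if "e' \<in> E" for e'
          using that V \<open>e = V\<close> c2 False e fin unfolding sgraph_def by (metis card_subset_eq)
        then show ?thesis using e by blast
      qed
      ultimately show ?thesis using c2 by simp
    qed
    then have "spanning_tree V E" using cn unfolding spanning_tree_def by simp
    then show ?thesis unfolding xuong_def using \<open>paired {} {}\<close> by (metis Diff_cancel order_refl)
  next
    case True
    then obtain e e' x where e: "e \<in> E" "e' \<in> E" "e \<noteq> e'" "x \<in> e" "x \<in> e'" by blast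
    let ?E = "E - {e} - {e'}"
    have sgE: "sgraph V (E - {e})" "sgraph V ?E" by (auto intro: sgraph_mono[OF V])
    have cE: "card (E - {e}) + 1 = card E" "card ?E + 1 = card (E - {e})"
      using card_Suc_Diff1[OF fin(2) e(1)] card_Suc_Diff1[of "E - {e}" e'] fin e by auto
    show ?thesis
    proof (cases "spread V ?E")
      case True
      have "xuong V ?E" using less.hyps[OF _ sgE(2) less.prems(2) True] cE by linarith
      then obtain T J where T: "T \<subseteq> ?E" "spanning_tree V T" "paired (?E - T) J" unfolding xuong_def by blast
      have "paired (insert e (insert e' (?E - T))) (insert x J)"
        by (rule paired.pair[OF T(3)]) (use e in auto)
      also have "insert e (insert e' (?E - T)) = E - T" using T(1) e by auto
      finally show ?thesis using T unfolding xuong_def by blast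
    next
      case False
      then obtain Q where Q: "partition_on V Q" "sum (weight ?E) Q > card (cross_edges ?E Q) + 1"
        unfolding spread_def by (auto simp: not_le)
      have "e' \<in> E - {e}" using e by auto
      \<comment> \<open>Each of the two deletions worsens the gap by at most one. So in
        \<open>E\<close> the partition \<open>Q\<close> falls short of equality by at most one, and
        parity makes it tight.\<close>
      have "card (cross_edges E Q) \<le> sum (weight E) Q"
        using remove_edge_weight_le[OF V e(1) Q(1)] remove_edge_weight_le[OF sgE(1) \<open>e' \<in> E - {e}\<close> Q(1)] Q(2)
        by linarith
      moreover have "sum (weight E) Q \<le> card (cross_edges E Q) + 1" using sp Q unfolding spread_def by blast
      moreover have "odd (sum (weight E) Q + card (cross_edges E Q))"
        using defect_parity[OF V Q(1)] par by simp
      ultimately have "sum (weight E) Q = card (cross_edges E Q) + 1"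
        by (metis Suc_eq_plus1 even_add le_SucE le_antisym)
      then have tQ: "tight V E Q" using Q unfolding tight_def by simp
      \<comment> \<open>Deleting two edges keeps the parity of the Betti number, so the trivial
        partition is not the violated one.\<close>
      have "Q \<noteq> {V}"
      proof
        assume "Q = {V}"
        moreover have "weight ?E V = weight E V"
          using cE within_whole[OF V] within_whole[OF sgE(2)] unfolding weight_def
          by (auto simp flip: cE)
        ultimately show False using Q(2) par by simp
      qed
      then have "card Q > 1" using card_partition_on_gt_1[OF fin(1) less.prems(2) Q(1)] by simp
      have bnd: "card Q' \<le> card V" if "tight V E Q'" for Q'
        using that fin card_partition_on[OF fin(1), of Q'] unfolding tight_def
        by (metis card_eq_sum partition_onD1 partition_onD3 Sup_upper card_gt_0_iff finite_subset
            One_nat_def Suc_leI sum_mono)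
      \<comment> \<open>The violated partition only witnesses that a nontrivial tight one exists.
        The recursion needs one with the most parts, as \<open>spread_odd_part\<close>
        demands.\<close>
      obtain Q0 where Q0: "tight V E Q0" "\<And>Q'. tight V E Q' \<Longrightarrow> card Q' \<le> card Q0"
        using ex_has_greatest_nat[of "tight V E" Q card "Suc (card V)"] tQ bnd
        by (auto simp: less_Suc_eq_le)
      have "card Q0 \<ge> 2" using Q0(2)[OF tQ] \<open>card Q > 1\<close> by simp
      have p0: "partition_on V Q0" using Q0(1) unfolding tight_def by simp
      have Pprop: "P \<subseteq> V" "P \<noteq> {}" "card P < card V" "card (within E P) \<le> card E" if P: "P \<in> Q0" for P
      proof -
        show PV: "P \<subseteq> V" "P \<noteq> {}" using p0 P unfolding partition_on_def by auto
        have "Q0 \<noteq> {P}" using \<open>card Q0 \<ge> 2\<close> by auto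
        then obtain P' where "P' \<in> Q0" "P' \<noteq> P" using P by blast
        moreover have "P' \<subseteq> V" "P' \<noteq> {}" using p0 \<open>P' \<in> Q0\<close> unfolding partition_on_def by auto
        ultimately have "P \<noteq> V" using partition_on_eqI[OF p0 P \<open>P' \<in> Q0\<close>] by blast
        then show "card P < card V" using PV fin by (simp add: psubset_card_mono psubset_eq)
        show "card (within E P) \<le> card E" using fin within_subset by (metis card_mono)
      qed
      show ?thesis
      proof (rule xuong_of_parts[OF V Q0(1) \<open>card Q0 \<ge> 2\<close> sp])
        fix P assume P: "P \<in> Q0"
        note PP = Pprop[OF P]
        show "xuong P (within E P)" if w: "weight E P = 1"
          using less.hyps[OF _ sgraph_within[OF V PP(1)] PP(2) spread_even_part[OF V sp Q0(1) P w]] PP(3,4) by linarith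
        assume w: "weight E P = 2"
        show "xuong P (within E P - {e})" if e: "e \<in> within E P" for e
        proof -
          have "spread P (within E P - {e})" by (rule spread_odd_part[OF V sp Q0(1) P w Q0(2) e])
          moreover have "card (within E P - {e}) \<le> card (within E P)" using fin by (simp add: card_Diff1_le)
          moreover have "sgraph P (within E P - {e})" using sgraph_mono[OF sgraph_within[OF V PP(1)]] by blast
          ultimately show ?thesis using less.hyps[of P "within E P - {e}"] PP by linarith
        qed
        fix x assume x: "x \<in> P"
        show "\<exists>e\<in>within E P. x \<in> e"
        proof -
          have "P \<noteq> {x}"
          proof
            assume "P = {x}"
            moreover have "within E {x} = {}" unfolding within_def
              using V by (auto simp: sgraph_def dest!: bspec subset_singletonD)
            ultimately show False using w unfolding weight_def by (auto split: if_splits)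
          qed
          \<comment> \<open>Splitting off \<open>x\<close> turns the slack of odd parts into a lower
            bound on the edges between \<open>x\<close> and the rest of \<open>P\<close>.\<close>
          let ?Y = "{{x}, P - {x}}"
          have Y: "partition_on P ?Y" "?Y \<noteq> {P}"
            using x \<open>P \<noteq> {x}\<close> by (auto simp: partition_on_def disjoint_def)
          have "sum (weight E) ?Y \<le> card (cross_edges (within E P) ?Y)"
            by (rule odd_part_slack[OF V sp Q0(1) P w Q0(2) Y])
          moreover have "sum (weight E) ?Y = weight E {x} + weight E (P - {x})"
            by (subst sum.insert) auto
          ultimately have "card (cross_edges (within E P) ?Y) \<noteq> 0" using weight_pos[of E "{x}"] by linarith
          then obtain e where "e \<in> cross_edges (within E P) ?Y" by (metis card.empty equals0I)
          then have "e \<in> within E P" "\<not> e \<subseteq> P - {x}" unfolding crossing_def by auto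
          then show ?thesis unfolding within_def by blast
        qed
      qed
    qed
  qed
qed

section \<open>Decycling sets of subcubic graphs\<close>

lemma card_2_eqI: "card e = 2 \<Longrightarrow> a \<in> e \<Longrightarrow> b \<in> e \<Longrightarrow> a \<noteq> b \<Longrightarrow> e = {a, b}"
  by (auto simp: card_2_iff)

lemma paired_finite: "paired S J \<Longrightarrow> finite S"
  by (induction rule: paired.induct) auto

text \<open>The last pair already gives its common vertex degree two, so the earlier edges avoid it.
  An earlier common vertex has both its edges already and cannot lie on the new ones. Hence
  different pairs have different common vertices, and each edge contains exactly one of
  them.\<close>

lemma paired_degree_2:
  assumes "paired S J" "\<And>x. card {e \<in> S. x \<in> e} \<le> 2"
  shows "(\<forall>e\<in>S. \<exists>j\<in>J. j \<in> e) \<and> (\<forall>j\<in>J. card {e \<in> S. j \<in> e} = 2)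
    \<and> (\<forall>e\<in>S. \<forall>j\<in>J. \<forall>j'\<in>J. j \<in> e \<longrightarrow> j' \<in> e \<longrightarrow> j = j')"
  using assms
proof (induction rule: paired.induct)
  case (pair S J e e' x)
  let ?S = "insert e (insert e' S)"
  have fin: "finite S" using paired_finite pair by blast
  have sub: "card {f \<in> S. y \<in> f} \<le> card {f \<in> ?S. y \<in> f}" for y
    by (rule card_mono) (use fin in auto)
  have "card {f \<in> S. y \<in> f} \<le> 2" for y using sub[of y] pair.prems[of y] by linarith
  note IH = pair.IH[OF this]
  have "{f \<in> ?S. x \<in> f} = insert e (insert e' {f \<in> S. x \<in> f})" using pair by auto
  then have "card {f \<in> ?S. x \<in> f} = 2 + card {f \<in> S. x \<in> f}" using pair.hyps fin by simp
  then have c0: "card {f \<in> S. x \<in> f} = 0" "card {f \<in> ?S. x \<in> f} = 2" using pair.prems[of x] by auto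
  then have nx: "x \<notin> f" if "f \<in> S" for f using fin that by auto
  have eqS: "{f \<in> S. j \<in> f} = {f \<in> ?S. j \<in> f}" if "j \<in> J" for j
    by (rule card_seteq) (use fin IH that pair.prems[of j] in auto)
  have nJ: "j \<notin> e" "j \<notin> e'" if "j \<in> J" for j using eqS[OF that] pair.hyps by blast+
  show ?case
  proof (intro conjI)
    show "\<forall>f\<in>?S. \<exists>j\<in>insert x J. j \<in> f" using IH pair.hyps by auto
    show "\<forall>j\<in>insert x J. card {f \<in> ?S. j \<in> f} = 2" using IH c0 eqS by auto
    show "\<forall>f\<in>?S. \<forall>j\<in>insert x J. \<forall>j'\<in>insert x J. j \<in> f \<longrightarrow> j' \<in> f \<longrightarrow> j = j'"
      using IH nx nJ by auto
  qed
qed simp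

text \<open>Unless there is only one vertex, each vertex has a tree edge, so cotree degrees are at
  most two and a common vertex of a pair has two cotree edges and one tree edge. Removing these
  leaves removes all cotree edges, and a subtree is left. The statement on degrees later keeps
  \<open>J\<close> away from neighbours of deleted vertices.\<close>

lemma decycling_of_xuong:
  assumes V: "sgraph V E" "V \<noteq> {}" and deg: "\<And>v. v \<in> V \<Longrightarrow> card {e \<in> E. v \<in> e} \<le> 3" and "xuong V E"
  obtains J where "J \<subseteq> V" "spanning_tree (V - J) (within E (V - J))" "within E J = {}"
    "\<And>j. j \<in> J \<Longrightarrow> card {e \<in> E. j \<in> e} = 3"
proof -
  note fin = sgraph_finite[OF V(1)]
  obtain T J where TE: "T \<subseteq> E" and T: "conn V T" "card T + 1 = card V" and pr: "paired (E - T) J"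
    using assms(4) unfolding xuong_def spanning_tree_def by blast
  have finT: "finite T" using TE fin finite_subset by blast
  have edge: "e \<subseteq> V" "card e = 2" if "e \<in> E" for e using V(1) that unfolding sgraph_def by auto
  have split: "card {e \<in> E. v \<in> e} = card {e \<in> E - T. v \<in> e} + card {e \<in> T. v \<in> e}" for v
  proof -
    have "{e \<in> E. v \<in> e} = {e \<in> E - T. v \<in> e} \<union> {e \<in> T. v \<in> e}" using TE by auto
    then show ?thesis using card_Un_disjoint[of "{e \<in> E - T. v \<in> e}" "{e \<in> T. v \<in> e}"] fin finT by auto
  qed
  have Tdeg: "card {e \<in> T. v \<in> e} \<ge> 1" if "v \<in> V" "V \<noteq> {v}" for v
  proof -
    have "\<exists>e\<in>T. e \<inter> {v} \<noteq> {} \<and> e \<inter> (V - {v}) \<noteq> {}"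
      using T(1) that unfolding conn_def by (metis empty_subsetI insert_not_empty insert_subset)
    then have "{e \<in> T. v \<in> e} \<noteq> {}" by blast
    then show ?thesis using finT by (simp add: Suc_leI card_gt_0_iff)
  qed
  have E_empty: "E = {}" if "V = {v}" for v
  proof (rule ccontr)
    assume "E \<noteq> {}"
    then obtain e where "e \<in> E" by blast
    then have "e \<subseteq> {v}" "card e = 2" using edge that by auto
    then show False using card_mono[of "{v}" e] by simp
  qed
  have "card {e \<in> E - T. v \<in> e} \<le> 2" for v
  proof (cases "v \<in> V \<and> V \<noteq> {v}")
    case True
    then show ?thesis using split[of v] Tdeg[of v] deg[of v] by linarith
  next
    case False
    then have "{e \<in> E - T. v \<in> e} = {}" using edge E_empty by blast
    then show ?thesis by (simp only: card.empty)
  qed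
  from paired_degree_2[OF pr this]
  have cov: "\<And>e. e \<in> E - T \<Longrightarrow> \<exists>j\<in>J. j \<in> e" and J2: "\<And>j. j \<in> J \<Longrightarrow> card {e \<in> E - T. j \<in> e} = 2"
    and uniq: "\<And>e j j'. e \<in> E - T \<Longrightarrow> j \<in> J \<Longrightarrow> j' \<in> J \<Longrightarrow> j \<in> e \<Longrightarrow> j' \<in> e \<Longrightarrow> j = j'"
    by blast+
  have Jedge: "\<exists>e\<in>E - T. j \<in> e" if "j \<in> J" for j
  proof (rule ccontr)
    assume "\<not> ?thesis"
    then have "{e \<in> E - T. j \<in> e} = {}" by blast
    then show False using J2[OF that] by (metis card.empty zero_neq_numeral)
  qed
  have JV: "J \<subseteq> V" using Jedge edge by blast
  have finJ: "finite J" using JV fin finite_subset by blast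
  have JT: "card {e \<in> T. j \<in> e} = 1" "card {e \<in> E. j \<in> e} = 3" if "j \<in> J" for j
  proof -
    have "j \<in> V" "V \<noteq> {j}" using that JV Jedge E_empty by blast+
    then show "card {e \<in> T. j \<in> e} = 1" "card {e \<in> E. j \<in> e} = 3"
      using Tdeg deg[of j] split[of j] J2[OF that] by force+
  qed
  have TJ: "e = f" if tj: "j \<in> J" "e \<in> T" "f \<in> T" "j \<in> e" "j \<in> f" for e f j
  proof -
    obtain t where "{e \<in> T. j \<in> e} = {t}" using JT(1)[OF tj(1)] by (metis card_1_singletonE)
    then show ?thesis using tj(2-5) by (metis (mono_tags, lifting) mem_Collect_eq singletonD)
  qed
  \<comment> \<open>A tree edge joining two leaves is a component of the tree, hence all of
    \<open>V\<close>. A cotree edge at \<open>j\<close> would then coincide with it.\<close>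
  have Tuniq: "j = j'" if jj: "e \<in> T" "j \<in> J" "j' \<in> J" "j \<in> e" "j' \<in> e" for e j j'
  proof (rule ccontr)
    assume "j \<noteq> j'"
    have "e = {j, j'}"
      using edge(2)[of e] TE jj \<open>j \<noteq> j'\<close> by (intro card_2_eqI) auto
    show False
    proof (cases "e = V")
      case False
      then obtain f where "f \<in> T" "f \<inter> e \<noteq> {}" "f \<inter> (V - e) \<noteq> {}"
        using T(1) jj TE edge[of e] unfolding conn_def by (metis empty_iff subsetD)
      then show False using TJ[of j e f] TJ[of j' e f] jj \<open>e = {j, j'}\<close> by blast
    next
      case True
      obtain g where "g \<in> E - T" "j \<in> g" using Jedge jj by blast
      then have "g \<subseteq> V" "card g = 2" "card e = 2" using edge jj TE by auto
      then have "g = e" using True fin by (metis card_subset_eq)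
      then show False using \<open>g \<in> E - T\<close> jj by blast
    qed
  qed
  have "within E J = {}"
  proof (rule ccontr)
    assume "within E J \<noteq> {}"
    then obtain e where e: "e \<in> E" "e \<subseteq> J" unfolding within_def by blast
    then obtain a b where "e = {a, b}" "a \<noteq> b" using edge by (metis card_2_iff)
    then show False using e uniq[of e a b] Tuniq[of e a b] by blast
  qed
  have wE: "within E (V - J) = T - {e \<in> T. e \<inter> J \<noteq> {}}"
    unfolding within_def using cov TE edge by blast
  have "card {e \<in> T. e \<inter> J \<noteq> {}} = card J"
  proof -
    have "{e \<in> T. e \<inter> J \<noteq> {}} = (\<Union>j\<in>J. {e \<in> T. j \<in> e})" by blast
    moreover have "card (\<Union>j\<in>J. {e \<in> T. j \<in> e}) = (\<Sum>j\<in>J. card {e \<in> T. j \<in> e})"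
      using Tuniq by (intro card_UN_disjoint) (use finJ finT in auto)
    ultimately show ?thesis using JT by simp
  qed
  then have c1: "card (within E (V - J)) + card J = card T"
    using wE finT by (metis (no_types, lifting) card_Diff_subset card_mono finite_subset le_add_diff_inverse2 mem_Collect_eq subsetI)
  have "card (V - J) + card J = card V"
    using JV fin finJ by (metis card_Diff_subset card_mono le_add_diff_inverse2)
  then have "card (within E (V - J)) + 1 = card (V - J)" using c1 T(2) by linarith
  moreover have "conn (V - J) (within E (V - J))" unfolding conn_def
  proof (intro allI impI)
    fix S assume S: "S \<subseteq> V - J" "S \<noteq> {}" "S \<noteq> V - J"
    \<comment> \<open>Adding the leaves that hang on \<open>S\<close> ensures that a tree edge
      leaving \<open>S'\<close> avoids \<open>J\<close> and so survives.\<close>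
    define S' where "S' = S \<union> {j \<in> J. \<exists>e\<in>T. j \<in> e \<and> e \<inter> S \<noteq> {}}"
    have "S' \<subseteq> V" "S' \<noteq> {}" "S' \<noteq> V" using S JV unfolding S'_def by blast+
    then obtain f where f: "f \<in> T" "f \<inter> S' \<noteq> {}" "f \<inter> (V - S') \<noteq> {}" using T(1) unfolding conn_def by blast
    have "f \<inter> J = {}"
    proof (rule ccontr)
      assume "f \<inter> J \<noteq> {}"
      then obtain j where j: "j \<in> f" "j \<in> J" by blast
      obtain y where y: "f = {j, y}" using j edge[of f] f TE by (metis card_2_iff insert_commute insert_iff singletonD subsetD)
      have "y \<noteq> j" using y edge[of f] f TE by auto
      then have "y \<notin> J" using Tuniq[of f j y] j f y by blast
      have "j \<in> S' \<longleftrightarrow> f \<inter> S \<noteq> {}" using j f TJ[of j f] S unfolding S'_def by blast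
      moreover have "f \<inter> S \<noteq> {} \<longleftrightarrow> y \<in> S" using y j S by blast
      moreover have "y \<in> S \<longleftrightarrow> y \<in> S'" using \<open>y \<notin> J\<close> unfolding S'_def by blast
      ultimately show False using f y by blast
    qed
    then have "f \<in> within E (V - J)" using wE f by blast
    moreover have "f \<inter> S \<noteq> {}" "f \<inter> (V - J - S) \<noteq> {}" using f \<open>f \<inter> J = {}\<close> unfolding S'_def by blast+
    ultimately show "\<exists>e\<in>within E (V - J). e \<inter> S \<noteq> {} \<and> e \<inter> (V - J - S) \<noteq> {}" by blast
  qed
  ultimately show ?thesis
    using that[of J] JV \<open>within E J = {}\<close> JT(2) unfolding spanning_tree_def by blast
qed

text \<open>The last condition is 3-edge-connectedness: in a cubic graph, \<open>S\<close> is left by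
  \<open>3 * card S - 2 * card (within E S)\<close> edges.\<close>

definition cubic3 :: "'a set \<Rightarrow> 'a set set \<Rightarrow> bool" where
  "cubic3 V E \<longleftrightarrow> sgraph V E \<and> V \<noteq> {} \<and> (\<forall>v\<in>V. card {e \<in> E. v \<in> e} = 3) \<and>
    (\<forall>S\<subseteq>V. S \<noteq> {} \<longrightarrow> S \<noteq> V \<longrightarrow> 2 * card (within E S) + 3 \<le> 3 * card S)"

text \<open>In a cubic graph this says that at least four edges leave \<open>S\<close>. Single
  vertices are excluded on both sides because their three edges always form a cut.\<close>

definition no_3cut :: "'a set \<Rightarrow> 'a set set \<Rightarrow> bool" where
  "no_3cut V E \<longleftrightarrow> (\<forall>S\<subseteq>V. 2 \<le> card S \<longrightarrow> card S + 2 \<le> card V \<longrightarrow> 2 * card (within E S) + 4 \<le> 3 * card S)"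

text \<open>The edges inside \<open>J\<close> are bounded separately, because gluing may exchange
  one such edge for another.\<close>

definition decycling :: "'a set \<Rightarrow> 'a set set \<Rightarrow> 'a set \<Rightarrow> bool" where
  "decycling V E J \<longleftrightarrow> J \<subseteq> V \<and> spanning_tree (V - J) (within E (V - J))"

lemma degree_sum:
  assumes "sgraph V E" "S \<subseteq> V"
  shows "(\<Sum>v\<in>S. card {e \<in> E. v \<in> e}) = (\<Sum>e\<in>E. card (e \<inter> S))"
proof -
  note fin = sgraph_finite[OF assms(1)]
  have finS: "finite S" using assms(2) fin finite_subset by blast
  have "(\<Sum>v\<in>S. card {e \<in> E. v \<in> e}) = (\<Sum>v\<in>S. \<Sum>e\<in>E. if v \<in> e then 1 else 0)"
    using fin by (simp add: sum.If_cases Int_def)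
  also have "\<dots> = (\<Sum>e\<in>E. \<Sum>v\<in>S. if v \<in> e then 1 else 0)" by (rule sum.swap)
  also have "\<dots> = (\<Sum>e\<in>E. card (e \<inter> S))"
    using finS by (simp add: sum.If_cases Int_def conj_commute)
  finally show ?thesis .
qed

lemma cubic_edges:
  assumes "sgraph V E" "\<And>v. v \<in> V \<Longrightarrow> card {e \<in> E. v \<in> e} = 3"
  shows "2 * card E = 3 * card V"
proof -
  have "(\<Sum>e\<in>E. card (e \<inter> V)) = (\<Sum>e\<in>E. 2)"
    using assms(1) by (intro sum.cong) (auto simp: sgraph_def Int_absorb2)
  then show ?thesis using degree_sum[OF assms(1) order_refl] assms(2) by simp
qed

text \<open>By \<open>sparse\<close>, at least twice the weight of a part leaves it in the cubic
  graph. Summing over a partition counts crossing edges twice and the at most four edge ends lost to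
  \<open>X\<close> once; this gives the required inequality up to one unit, which parity removes. A
  vertex chosen by the Xuong tree has all its three edges in \<open>F\<close>, so none of them leads
  to \<open>X\<close>.\<close>

lemma decycling_delete:
  assumes V: "sgraph V E" and deg: "\<And>v. v \<in> V \<Longrightarrow> card {e \<in> E. v \<in> e} = 3"
    and X: "X \<subseteq> V" "V - X \<noteq> {}"
    and F: "F = within E (V - X)" "3 * card (V - X) \<le> 2 * card F + 4" "odd (card F + card (V - X))"
    and sparse: "\<And>P. P \<subseteq> V - X \<Longrightarrow> P \<noteq> {} \<Longrightarrow> 2 * weight F P + 2 * card (within F P) \<le> 3 * card P"
  shows "\<exists>J. X \<subseteq> J \<and> decycling V E J \<and> within E J = within E X"
proof -
  let ?U = "V - X"
  note fin = sgraph_finite[OF V]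
  have U: "sgraph ?U F" unfolding F(1) by (rule sgraph_within[OF V]) auto
  have FE: "F \<subseteq> E" using F(1) within_subset by blast
  have "spread ?U F" unfolding spread_def
  proof (intro allI impI)
    fix Q assume Q: "partition_on ?U Q"
    have "(\<Sum>P\<in>Q. 2 * weight F P + 2 * card (within F P)) \<le> (\<Sum>P\<in>Q. 3 * card P)"
      using Q by (intro sum_mono sparse) (auto simp: partition_on_def)
    then have "2 * sum (weight F) Q + 2 * (\<Sum>P\<in>Q. card (within F P)) \<le> 3 * card ?U"
      using card_partition_on[OF _ Q] fin by (simp add: sum.distrib sum_distrib_left)
    then have "sum (weight F) Q \<le> card (cross_edges F Q) + 2"
      using card_edges_partition[OF U Q] F(2) by linarith
    moreover have "odd (sum (weight F) Q + card (cross_edges F Q))" using defect_parity[OF U Q] F(3) by simp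
    ultimately show "sum (weight F) Q \<le> card (cross_edges F Q) + 1"
      by (cases "sum (weight F) Q = card (cross_edges F Q) + 2") auto
  qed
  then have "xuong ?U F" using xuong_if_spread[OF U X(2)] by simp
  moreover have "card {e \<in> F. v \<in> e} \<le> 3" if "v \<in> ?U" for v
  proof -
    have "card {e \<in> F. v \<in> e} \<le> card {e \<in> E. v \<in> e}" by (rule card_mono) (use fin FE in auto)
    then show ?thesis using deg[of v] that by simp
  qed
  ultimately obtain J where J: "J \<subseteq> ?U" "spanning_tree (?U - J) (within F (?U - J))" "within F J = {}"
    "\<And>j. j \<in> J \<Longrightarrow> card {e \<in> F. j \<in> e} = 3"
    using decycling_of_xuong[OF U X(2)] by blast
  have JX: "V - (J \<union> X) = ?U - J" by blast
  have "within F (?U - J) = within E (?U - J)" unfolding F(1) by (rule within_within) auto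
  then have "decycling V E (J \<union> X)" using J X unfolding decycling_def JX by auto
  moreover have "within E (J \<union> X) = within E X"
  proof -
    have "e \<subseteq> X" if e: "e \<in> E" "e \<subseteq> J \<union> X" for e
    proof (rule ccontr)
      assume "\<not> e \<subseteq> X"
      then obtain j where j: "j \<in> e" "j \<in> J" using e by blast
      then have "j \<in> V" using J by blast
      have "{f \<in> F. j \<in> f} = {f \<in> E. j \<in> f}"
        by (rule card_seteq) (use fin FE J(4)[OF j(2)] deg[OF \<open>j \<in> V\<close>] in auto)
      then have "e \<in> F" using e j by blast
      then have "e \<subseteq> J" using e unfolding F(1) within_def by blast
      then show False using J(3) \<open>e \<in> F\<close> unfolding within_def by blast
    qed
    then show ?thesis unfolding within_def by blast
  qed
  ultimately show ?thesis by (intro exI[of _ "J \<union> X"]) auto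
qed

section \<open>Three-edge-cuts of cubic graphs\<close>

lemma within_single: "sgraph V E \<Longrightarrow> within E {x} = {}"
  unfolding within_def sgraph_def
  by (auto dest!: bspec subset_singletonD)

lemma weight_single: "sgraph V E \<Longrightarrow> weight E {x} = 1"
  by (simp add: weight_def within_single)

lemma card_within_split:
  assumes "finite E" "S = T \<union> {x}"
  shows "card (within E S) = card (within E (S - {x})) + card {e \<in> within E S. x \<in> e}"
proof -
  have "within E S = within E (S - {x}) \<union> {e \<in> within E S. x \<in> e}" unfolding within_def by auto
  moreover have "within E (S - {x}) \<inter> {e \<in> within E S. x \<in> e} = {}" unfolding within_def by auto
  ultimately show ?thesis
    by (metis (no_types, lifting) assms(1) card_Un_disjoint finite_Un finite_within)
qed

definition cut_between :: "'a set set \<Rightarrow> 'a set \<Rightarrow> 'a set \<Rightarrow> 'a set set" where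
  "cut_between E S R = {e \<in> E. e \<inter> S \<noteq> {} \<and> e \<inter> R \<noteq> {}}"

lemma cut_count:
  assumes V: "sgraph V E" and deg: "\<And>v. v \<in> V \<Longrightarrow> card {e \<in> E. v \<in> e} = 3" and S: "S \<subseteq> V"
  shows "3 * card S = 2 * card (within E S) + card (cut_between E S (V - S))"
proof -
  note fin = sgraph_finite[OF V]
  have "3 * card S = (\<Sum>v\<in>S. card {e \<in> E. v \<in> e})" using deg S by (simp add: subset_iff)
  also have "\<dots> = (\<Sum>e\<in>E. card (e \<inter> S))" by (rule degree_sum[OF V S])
  also have "\<dots> = (\<Sum>e\<in>E. (if e \<in> within E S then 2 else 0) + (if e \<in> cut_between E S (V - S) then 1 else 0))"
  proof (rule sum.cong)
    fix e assume e: "e \<in> E"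
    obtain u v where uv: "e = {u, v}" "u \<noteq> v" "u \<in> V" "v \<in> V" using sgraph_edgeE[OF V e] .
    show "card (e \<inter> S) = (if e \<in> within E S then 2 else 0) + (if e \<in> cut_between E S (V - S) then 1 else 0)"
      using uv e by (cases "u \<in> S"; cases "v \<in> S") (auto simp: within_def cut_between_def)
  qed simp
  also have "\<dots> = 2 * card (within E S) + card (cut_between E S (V - S))"
  proof -
    have "E \<inter> within E S = within E S" "E \<inter> cut_between E S (V - S) = cut_between E S (V - S)"
      unfolding within_def cut_between_def by auto
    then show ?thesis using fin by (simp add: sum.distrib sum.If_cases)
  qed
  finally show ?thesis .
qed

lemma cubic3D:
  assumes "cubic3 V E"
  shows "sgraph V E" "V \<noteq> {}" "\<And>v. v \<in> V \<Longrightarrow> card {e \<in> E. v \<in> e} = 3"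
    "\<And>S. S \<subseteq> V \<Longrightarrow> S \<noteq> {} \<Longrightarrow> S \<noteq> V \<Longrightarrow> 2 * card (within E S) + 3 \<le> 3 * card S"
    "2 * card E = 3 * card V"
proof -
  show V: "sgraph V E" "V \<noteq> {}" and deg: "\<And>v. v \<in> V \<Longrightarrow> card {e \<in> E. v \<in> e} = 3"
    using assms unfolding cubic3_def by simp_all
  show "2 * card (within E S) + 3 \<le> 3 * card S" if "S \<subseteq> V" "S \<noteq> {}" "S \<noteq> V" for S
    using assms that unfolding cubic3_def by simp
  show "2 * card E = 3 * card V" by (rule cubic_edges[OF V(1) deg])
qed

text \<open>A single vertex has weight 1 and three edges; a larger part has weight at most 2 and at
  least four edges leaving it.\<close>

lemma sparse_part:
  assumes V: "cubic3 V E" and "no_3cut V E" and P: "P \<subseteq> U" "U \<subseteq> V" "P \<noteq> {}" "card P + 2 \<le> card V"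
  shows "2 * weight (within E U) P + 2 * card (within (within E U) P) \<le> 3 * card P"
proof -
  have "finite P" using sgraph_finite[OF cubic3D(1)[OF V]] P(1,2) by (meson finite_subset)
  then consider "card P = 1" | "card P \<ge> 2" using P by (metis One_nat_def Suc_1 Suc_leI card_gt_0_iff le_neq_implies_less)
  then show ?thesis
  proof cases
    case 1
    then obtain x where "P = {x}" by (metis card_1_singletonE)
    then show ?thesis
      using weight_within[OF P(1)] within_within[OF P(1)] weight_single[OF cubic3D(1)[OF V]] within_single[OF cubic3D(1)[OF V]]
      by simp
  next
    case 2
    then have "2 * card (within E P) + 4 \<le> 3 * card P" using assms(2) P unfolding no_3cut_def by blast
    then show ?thesis
      using weight_within[OF P(1), of E] within_within[OF P(1), of E] weight_le[of E P] by simp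
  qed
qed

lemma even_decycling:
  assumes V: "cubic3 V E" and nc: "no_3cut V E" and par: "odd (card E + card V)" and v: "v \<in> V"
  shows "\<exists>J. v \<in> J \<and> decycling V E J \<and> within E J = {}"
proof -
  note c = cubic3D[OF V]
  note fin = sgraph_finite[OF c(1)]
  let ?U = "V - {v}"
  let ?F = "within E ?U"
  have cF: "card E = card ?F + 3"
    using card_within_split[OF fin(2), of V V v] v c(3)[OF v] within_whole[OF c(1)] by (simp add: insert_absorb)
  have cU: "card V = card ?U + 1" using v fin by (metis Suc_eq_plus1 card_Suc_Diff1)
  have "?U \<noteq> {}"
  proof
    assume a: "?U = {}"
    then have "?F = {}" using sgraph_edge_nonempty[OF c(1)] unfolding within_def by auto
    then have "card ?F = 0" "card ?U = 0" by (metis card.empty) (metis a card.empty)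
    then show False using cF cU c(5) by simp
  qed
  have par': "odd (card ?F + card ?U)" using par cF cU by simp
  have "\<exists>J. {v} \<subseteq> J \<and> decycling V E J \<and> within E J = within E {v}"
  proof (rule decycling_delete[OF c(1) c(3) _ \<open>?U \<noteq> {}\<close> refl _ par'])
    show "{v} \<subseteq> V" using v by simp
    show "3 * card ?U \<le> 2 * card ?F + 4" using cF cU c(5) by linarith
    fix P assume P: "P \<subseteq> ?U" "P \<noteq> {}"
    show "2 * weight ?F P + 2 * card (within ?F P) \<le> 3 * card P"
    proof (cases "P = ?U")
      case True
      have "weight ?F ?U = 1" using par' within_within[of ?U ?U E] unfolding weight_def by simp
      then show ?thesis using True within_within[of ?U ?U E] cF cU c(5) by simp
    next
      case False
      then have "card P < card ?U" using P fin by (simp add: psubset_card_mono psubset_eq)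
      then show ?thesis using cU by (intro sparse_part[OF V nc P(1) _ P(2)]) auto
    qed
  qed auto
  then show ?thesis using within_single[OF c(1)] by auto
qed

lemma odd_decycling:
  assumes V: "cubic3 V E" and nc: "no_3cut V E" and par: "even (card E + card V)"
  shows "\<exists>J. decycling V E J \<and> card (within E J) \<le> 1"
proof -
  note c = cubic3D[OF V]
  note fin = sgraph_finite[OF c(1)]
  have "E \<noteq> {}" using c(2,5) fin by auto
  then obtain u v where uv: "{u, v} \<in> E" "u \<noteq> v" "u \<in> V" "v \<in> V" using sgraph_edgeE[OF c(1)] by blast
  let ?U = "V - {u, v}"
  let ?F = "within E ?U"
  have iuv: "{e \<in> E. u \<in> e} \<inter> {e \<in> E. v \<in> e} = {{u, v}}"
  proof -
    have "e = {u, v}" if e: "e \<in> E" "u \<in> e" "v \<in> e" for e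
    proof -
      have "card e = 2" using c(1) e unfolding sgraph_def by blast
      then show ?thesis using card_2_eqI e uv(2) by metis
    qed
    then show ?thesis using uv by blast
  qed
  have "card ({e \<in> E. u \<in> e} \<union> {e \<in> E. v \<in> e}) + 1 = 6"
    using card_Un_Int[of "{e \<in> E. u \<in> e}" "{e \<in> E. v \<in> e}"] fin c(3) uv iuv by simp
  moreover have E: "E = ?F \<union> ({e \<in> E. u \<in> e} \<union> {e \<in> E. v \<in> e})"
    using c(1) unfolding within_def sgraph_def by blast
  have "card E = card ?F + card ({e \<in> E. u \<in> e} \<union> {e \<in> E. v \<in> e})"
    by (subst E, rule card_Un_disjoint) (use fin in \<open>auto simp: within_def\<close>)
  ultimately have cF: "card E = card ?F + 5" by simp
  have cU: "card V = card ?U + 2"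
    using uv fin card_Diff_subset[of "{u, v}" V] card_mono[of V "{u, v}"] by simp
  have "?U \<noteq> {}"
  proof
    assume a: "?U = {}"
    then have "?F = {}" using sgraph_edge_nonempty[OF c(1)] unfolding within_def by auto
    then have "card ?F = 0" "card ?U = 0" by (metis card.empty) (metis a card.empty)
    then show False using cF cU c(5) by simp
  qed
  have par': "odd (card ?F + card ?U)" using par cF cU by simp
  have "\<exists>J. {u, v} \<subseteq> J \<and> decycling V E J \<and> within E J = within E {u, v}"
  proof (rule decycling_delete[OF c(1) c(3) _ \<open>?U \<noteq> {}\<close> refl _ par'])
    show "{u, v} \<subseteq> V" using uv by simp
    show "3 * card ?U \<le> 2 * card ?F + 4" using cF cU c(5) by linarith
    fix P assume P: "P \<subseteq> ?U" "P \<noteq> {}"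
    have "card P \<le> card ?U" using P fin by (intro card_mono) auto
    then show "2 * weight ?F P + 2 * card (within ?F P) \<le> 3 * card P"
      using cU by (intro sparse_part[OF V nc P(1) _ P(2)]) auto
  qed auto
  moreover have "card (within E {u, v}) \<le> 1"
  proof -
    have "within E {u, v} \<subseteq> {{u, v}}"
    proof
      fix e assume "e \<in> within E {u, v}"
      then have "e \<subseteq> {u, v}" "card e = 2" using c(1) unfolding within_def sgraph_def by auto
      then have "e = {u, v}" using uv(2) by (intro card_seteq) auto
      then show "e \<in> {{u, v}}" by simp
    qed
    then show ?thesis using card_mono[of "{{u, v}}"] by fastforce
  qed
  ultimately show ?thesis by auto
qed

definition three_cut :: "'a set \<Rightarrow> 'a set set \<Rightarrow> 'a set \<Rightarrow> bool" where
  "three_cut V E S \<longleftrightarrow> cubic3 V E \<and> S \<subseteq> V \<and> 2 \<le> card S \<and> 2 \<le> card (V - S) \<and>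
    card (cut_between E S (V - S)) = 3"

definition boundary :: "'a set \<Rightarrow> 'a set set \<Rightarrow> 'a set \<Rightarrow> 'a set" where
  "boundary V E S = {u \<in> S. \<exists>v\<in>V - S. {u, v} \<in> E}"

definition cap :: "'a set \<Rightarrow> 'a set set \<Rightarrow> 'a set \<Rightarrow> 'a \<Rightarrow> 'a set set" where
  "cap V E S w = within E S \<union> {{u, w} |u. u \<in> boundary V E S}"

lemma three_cut_sym: "three_cut V E S \<Longrightarrow> three_cut V E (V - S)"
  unfolding three_cut_def cut_between_def by (auto simp: double_diff conj_commute)

lemma three_cutD:
  assumes "three_cut V E S"
  shows "cubic3 V E" "S \<subseteq> V" "2 \<le> card S" "2 \<le> card (V - S)" "3 * card S = 2 * card (within E S) + 3"
proof -
  show c: "cubic3 V E" and S: "S \<subseteq> V" and "2 \<le> card S" "2 \<le> card (V - S)"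
    using assms unfolding three_cut_def by simp_all
  show "3 * card S = 2 * card (within E S) + 3"
    using cut_count[OF cubic3D(1)[OF c] cubic3D(3)[OF c] S] assms unfolding three_cut_def by simp
qed

lemma three_cut_degree:
  assumes t: "three_cut V E S" and u: "u \<in> S"
  shows "card {e \<in> within E S. u \<in> e} + card {v \<in> V - S. {u, v} \<in> E} = 3"
    "card {e \<in> within E S. u \<in> e} \<ge> 2"
proof -
  note d = three_cutD[OF t] note c = cubic3D[OF d(1)] note fin = sgraph_finite[OF c(1)]
  have finS: "finite S" using d(2) fin finite_subset by blast
  have "S - {u} \<noteq> {}" using d(3) u by (metis card.empty card.insert card_Diff_singleton diff_is_0_eq' finS
      insert_Diff not_one_le_zero One_nat_def Suc_1 Suc_le_mono empty_iff finite.emptyI)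
  then have "2 * card (within E (S - {u})) + 3 \<le> 3 * card (S - {u})" using c(4)[of "S - {u}"] d(2) u by blast
  moreover have "card (S - {u}) + 1 = card S" using finS u by (metis Suc_eq_plus1 card_Suc_Diff1)
  moreover have "card (within E S) = card (within E (S - {u})) + card {e \<in> within E S. u \<in> e}"
    using card_within_split[OF fin(2), of S S u] u by blast
  ultimately show "card {e \<in> within E S. u \<in> e} \<ge> 2" using d(5) by linarith
  have "{e \<in> E. u \<in> e} = {e \<in> within E S. u \<in> e} \<union> (\<lambda>v. {u, v}) ` {v \<in> V - S. {u, v} \<in> E}"
  proof (intro subset_antisym subsetI)
    fix e assume "e \<in> {e \<in> E. u \<in> e}"
    then have e: "e \<in> E" "u \<in> e" by auto
    obtain a b where ab: "e = {a, b}" "a \<noteq> b" "a \<in> V" "b \<in> V" using sgraph_edgeE[OF c(1) e(1)] .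
    then obtain v where "e = {u, v}" "v \<in> V" using e by blast
    then show "e \<in> {e \<in> within E S. u \<in> e} \<union> (\<lambda>v. {u, v}) ` {v \<in> V - S. {u, v} \<in> E}"
      using e u unfolding within_def by (cases "v \<in> S") auto
  next
    fix e assume "e \<in> {e \<in> within E S. u \<in> e} \<union> (\<lambda>v. {u, v}) ` {v \<in> V - S. {u, v} \<in> E}"
    then show "e \<in> {e \<in> E. u \<in> e}" unfolding within_def by auto
  qed
  moreover have "card ({e \<in> within E S. u \<in> e} \<union> (\<lambda>v. {u, v}) ` {v \<in> V - S. {u, v} \<in> E})
     = card {e \<in> within E S. u \<in> e} + card ((\<lambda>v. {u, v}) ` {v \<in> V - S. {u, v} \<in> E})"
    by (rule card_Un_disjoint) (use fin in \<open>auto simp: within_def\<close>)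
  moreover have "card ((\<lambda>v. {u, v}) ` {v \<in> V - S. {u, v} \<in> E}) = card {v \<in> V - S. {u, v} \<in> E}"
    by (rule card_image) (auto simp: inj_on_def doubleton_eq_iff)
  ultimately show "card {e \<in> within E S. u \<in> e} + card {v \<in> V - S. {u, v} \<in> E} = 3"
    using c(3)[of u] d(2) u by auto
qed

lemma three_cut_unique:
  assumes "three_cut V E S" "u \<in> S" "v \<in> V - S" "v' \<in> V - S" "{u, v} \<in> E" "{u, v'} \<in> E"
  shows "v = v'"
proof -
  have f: "finite {v \<in> V - S. {u, v} \<in> E}"
    using sgraph_finite[OF cubic3D(1)[OF three_cutD(1)[OF assms(1)]]] by simp
  have "card {v \<in> V - S. {u, v} \<in> E} \<le> 1" using three_cut_degree[OF assms(1,2)] by linarith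
  then show ?thesis using f assms(3-6) by (metis (mono_tags, lifting) One_nat_def card_le_Suc0_iff_eq mem_Collect_eq)
qed

lemma three_cut_inner_degree:
  assumes t: "three_cut V E S" and u: "u \<in> S"
  shows "card {e \<in> within E S. u \<in> e} + (if u \<in> boundary V E S then 1 else 0) = 3"
proof -
  have f: "finite {v \<in> V - S. {u, v} \<in> E}"
    using sgraph_finite[OF cubic3D(1)[OF three_cutD(1)[OF t]]] by simp
  have "card {v \<in> V - S. {u, v} \<in> E} \<le> 1" using three_cut_degree[OF t u] by linarith
  moreover have "u \<in> boundary V E S \<longleftrightarrow> card {v \<in> V - S. {u, v} \<in> E} \<noteq> 0"
    using f u unfolding boundary_def by auto
  ultimately have "card {v \<in> V - S. {u, v} \<in> E} = (if u \<in> boundary V E S then 1 else 0)" by auto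
  then show ?thesis using three_cut_degree(1)[OF t u] by simp
qed

lemma card_boundary:
  assumes t: "three_cut V E S"
  shows "card (boundary V E S) = 3"
proof -
  note d = three_cutD[OF t] note c = cubic3D[OF d(1)] note fin = sgraph_finite[OF c(1)]
  have finS: "finite S" using d(2) fin finite_subset by blast
  have sg: "sgraph S (within E S)" by (rule sgraph_within[OF c(1) d(2)])
  have "(\<Sum>u\<in>S. card {e \<in> within E S. u \<in> e}) = (\<Sum>e\<in>within E S. card (e \<inter> S))"
    by (rule degree_sum[OF sg order_refl])
  also have "\<dots> = (\<Sum>e\<in>within E S. 2)"
    using sg by (intro sum.cong) (auto simp: sgraph_def Int_absorb2)
  finally have "(\<Sum>u\<in>S. card {e \<in> within E S. u \<in> e}) = 2 * card (within E S)" by simp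
  moreover have "(\<Sum>u\<in>S. card {e \<in> within E S. u \<in> e}) + (\<Sum>u\<in>S. if u \<in> boundary V E S then 1 else 0) = (\<Sum>u\<in>S. 3)"
    unfolding sum.distrib[symmetric] by (rule sum.cong) (use three_cut_inner_degree[OF t] in auto)
  moreover have "(\<Sum>u\<in>S. if u \<in> boundary V E S then 1 else 0) = card (S \<inter> boundary V E S)"
    using finS by (simp add: sum.If_cases)
  moreover have "S \<inter> boundary V E S = boundary V E S" unfolding boundary_def by auto
  ultimately show ?thesis using d(5) by simp
qed

lemma cap_within: "w \<notin> T \<Longrightarrow> T \<subseteq> S \<Longrightarrow> within (cap V E S w) T = within E T"
  unfolding cap_def within_def by auto

lemma cubic3_cap:
  assumes t: "three_cut V E S" and w: "w \<notin> S"
  shows "cubic3 (S \<union> {w}) (cap V E S w)"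
proof -
  note d = three_cutD[OF t] note c = cubic3D[OF d(1)] note fin = sgraph_finite[OF c(1)]
  have finS: "finite S" using d(2) fin finite_subset by blast
  let ?B = "boundary V E S" and ?C = "cap V E S w"
  have BS: "?B \<subseteq> S" unfolding boundary_def by auto
  have sg: "sgraph (S \<union> {w}) ?C"
    using sgraph_within[OF c(1) d(2)] BS w unfolding sgraph_def cap_def by (auto simp: card_insert_if)
  have deg: "card {e \<in> ?C. v \<in> e} = 3" if v: "v \<in> S \<union> {w}" for v
  proof (cases "v = w")
    case True
    then have "{e \<in> ?C. v \<in> e} = (\<lambda>u. {u, w}) ` ?B" using w unfolding cap_def within_def by auto
    moreover have "card ((\<lambda>u. {u, w}) ` ?B) = card ?B"
      by (rule card_image) (auto simp: inj_on_def doubleton_eq_iff)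
    ultimately show ?thesis using card_boundary[OF t] by simp
  next
    case False
    then have vS: "v \<in> S" using v by simp
    have "{e \<in> ?C. v \<in> e} = {e \<in> within E S. v \<in> e} \<union> (if v \<in> ?B then {{v, w}} else {})"
      using False unfolding cap_def by auto
    moreover have "{v, w} \<notin> within E S" using w unfolding within_def by auto
    ultimately have "card {e \<in> ?C. v \<in> e} = card {e \<in> within E S. v \<in> e} + (if v \<in> ?B then 1 else 0)"
      using fin by simp
    then show ?thesis using three_cut_inner_degree[OF t vS] by simp
  qed
  have small: "2 * card (within ?C T) + 3 \<le> 3 * card T" if T: "T \<subseteq> S" "T \<noteq> {}" for T
  proof -
    have "within ?C T = within E T" by (rule cap_within) (use T w in auto)
    moreover have "S \<noteq> V" using d(4) by auto
    then have "T \<noteq> V" using T d(2) by auto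
    ultimately show ?thesis using c(4)[of T] T d(2) by simp
  qed
  have "2 * card (within ?C T) + 3 \<le> 3 * card T" if T: "T \<subseteq> S \<union> {w}" "T \<noteq> {}" "T \<noteq> S \<union> {w}" for T
  proof (cases "w \<in> T")
    case False
    then show ?thesis using small T by blast
  next
    case True
    let ?T = "S \<union> {w} - T"
    have "2 * card (within ?C ?T) + 3 \<le> 3 * card ?T" using small[of ?T] T True by blast
    moreover have "cut_between ?C ?T (S \<union> {w} - ?T) = cut_between ?C T ?T"
      using T(1) by (auto simp: cut_between_def double_diff)
    ultimately show ?thesis using cut_count[OF sg deg T(1)] cut_count[OF sg deg, of ?T] by simp
  qed
  then show ?thesis using sg deg unfolding cubic3_def by (intro conjI ballI allI impI) simp_all
qed

section \<open>Decycling sets of 3-sums\<close>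

text \<open>As \<open>w1\<close> is deleted with \<open>J1\<close>, the tree left on the side of \<open>S\<close> takes over the role of the
  vertex \<open>w2\<close> in the other tree.\<close>

lemma decycling_glue:
  assumes t: "three_cut V E S" and w1: "w1 \<notin> S" and w2: "w2 \<notin> V - S"
    and J1: "decycling (S \<union> {w1}) (cap V E S w1) J1" "w1 \<in> J1"
    and J2: "decycling (V - S \<union> {w2}) (cap V E (V - S) w2) J2" "w2 \<notin> J2"
    and hyp: "\<And>a b. a \<in> S \<Longrightarrow> b \<in> V - S \<Longrightarrow> {a, b} \<in> E \<Longrightarrow> a \<in> J1 \<Longrightarrow> b \<in> J2"
  shows "decycling V E ((J1 - {w1}) \<union> J2)"
proof -
  note d = three_cutD[OF t] note c = cubic3D[OF d(1)] note fin = sgraph_finite[OF c(1)]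
  note t' = three_cut_sym[OF t]
  define A where "A = S - J1"
  define B where "B = V - S - J2"
  have finAB: "finite A" "finite B" using fin d(2) finite_subset unfolding A_def B_def by auto
  have JV: "J1 \<subseteq> S \<union> {w1}" "J2 \<subseteq> V - S" using J1(1) J2 unfolding decycling_def by auto
  have AB: "V - ((J1 - {w1}) \<union> J2) = A \<union> B" "A \<inter> B = {}"
    using JV d(2) w1 J1(2) unfolding A_def B_def by auto
  have wA: "w1 \<notin> A" "A \<subseteq> S" "A \<subseteq> V" and wB: "w2 \<notin> B" "B \<subseteq> V - S"
    using w1 w2 d(2) unfolding A_def B_def by auto
  have "S \<union> {w1} - J1 = A" using w1 J1(2) unfolding A_def by auto
  then have trA: "conn A (within E A)" "card (within E A) + 1 = card A"
    using J1(1) cap_within[OF wA(1,2), of V E] unfolding decycling_def spanning_tree_def by auto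
  have "V - S \<union> {w2} - J2 = insert w2 B" using w2 J2(2) unfolding B_def by auto
  moreover define W where "W = within (cap V E (V - S) w2) (insert w2 B)"
  ultimately have trB: "conn (insert w2 B) W" "card W + 1 = card B + 1"
    using J2(1) wB finAB unfolding decycling_def spanning_tree_def by auto
  define N where "N = B \<inter> boundary V E (V - S)"
  have W: "W = within E B \<union> (\<lambda>b. {b, w2}) ` N"
    using wB w2 unfolding W_def cap_def N_def within_def boundary_def by auto
  have cW: "card W = card (within E B) + card N"
  proof -
    have "card W = card (within E B) + card ((\<lambda>b. {b, w2}) ` N)"
      unfolding W by (rule card_Un_disjoint) (use fin finAB wB in \<open>auto simp: within_def N_def\<close>)
    moreover have "card ((\<lambda>b. {b, w2}) ` N) = card N"
      by (rule card_image) (auto simp: inj_on_def doubleton_eq_iff)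
    ultimately show ?thesis by simp
  qed
  have partner: "\<exists>a\<in>A. {a, b} \<in> E" if b: "b \<in> N" for b
  proof -
    obtain a where a: "a \<in> S" "{a, b} \<in> E"
      using b d(2) unfolding N_def boundary_def by (auto simp: double_diff insert_commute)
    then show ?thesis using hyp[OF a(1) _ a(2)] b unfolding N_def B_def A_def by blast
  qed
  then obtain q where q: "\<And>b. b \<in> N \<Longrightarrow> q b \<in> A" "\<And>b. b \<in> N \<Longrightarrow> {q b, b} \<in> E" by metis
  have E_AB: "within E (A \<union> B) = within E A \<union> (within E B \<union> (\<lambda>b. {q b, b}) ` N)"
  proof (intro subset_antisym subsetI)
    fix e assume e: "e \<in> within E (A \<union> B)"
    show "e \<in> within E A \<union> (within E B \<union> (\<lambda>b. {q b, b}) ` N)"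
    proof (cases "e \<subseteq> A \<or> e \<subseteq> B")
      case True
      then show ?thesis using e unfolding within_def by auto
    next
      case False
      then obtain a b where ab: "a \<in> e" "a \<in> A" "b \<in> e" "b \<in> B" using e unfolding within_def by blast
      have "e \<in> E" "card e = 2" using e c(1) unfolding within_def sgraph_def by auto
      have "a \<noteq> b" using ab AB(2) by blast
      then have "e = {a, b}" using ab \<open>card e = 2\<close> by (intro card_2_eqI)
      then have bN: "b \<in> N" using ab \<open>e \<in> E\<close> wA wB unfolding N_def boundary_def by (auto simp: insert_commute)
      have "a = q b"
        by (rule three_cut_unique[OF t', of b])
          (use ab wA wB d(2) q[OF bN] \<open>e \<in> E\<close> \<open>e = {a, b}\<close> in \<open>auto simp: insert_commute\<close>)
      then show ?thesis using \<open>e = {a, b}\<close> bN by blast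
    qed
  next
    fix e assume "e \<in> within E A \<union> (within E B \<union> (\<lambda>b. {q b, b}) ` N)"
    then show "e \<in> within E (A \<union> B)" using q unfolding within_def N_def by auto
  qed
  have "card ((\<lambda>b. {q b, b}) ` N) = card N"
  proof (rule card_image, rule inj_onI)
    fix b b' assume bb: "b \<in> N" "b' \<in> N" "{q b, b} = {q b', b'}"
    have "b \<noteq> q b'" using bb q AB(2) unfolding N_def by blast
    then show "b = b'" using bb(3) by blast
  qed
  moreover have "card (within E (A \<union> B)) = card (within E A) + card (within E B \<union> (\<lambda>b. {q b, b}) ` N)"
    unfolding E_AB
  proof (rule card_Un_disjoint)
    have "e \<inter> B \<noteq> {}" if e: "e \<in> within E B \<union> (\<lambda>b. {q b, b}) ` N" for e
      using e sgraph_edge_nonempty[OF c(1)] unfolding N_def within_def by blast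
    then show "within E A \<inter> (within E B \<union> (\<lambda>b. {q b, b}) ` N) = {}"
      using AB(2) unfolding within_def by blast
  qed (use fin finAB in \<open>auto simp: N_def\<close>)
  moreover have "card (within E B \<union> (\<lambda>b. {q b, b}) ` N) = card (within E B) + card ((\<lambda>b. {q b, b}) ` N)"
  proof (rule card_Un_disjoint)
    show "within E B \<inter> (\<lambda>b. {q b, b}) ` N = {}" using q AB(2) unfolding within_def by blast
  qed (use fin finAB in \<open>auto simp: N_def\<close>)
  ultimately have "card (within E (A \<union> B)) + 1 = card (A \<union> B)"
    using trA(2) trB(2) cW finAB AB(2) by (simp add: card_Un_disjoint)
  moreover have "conn (A \<union> B) (within E (A \<union> B))"
    unfolding conn_def
  proof (intro allI impI)
    fix R assume R: "R \<subseteq> A \<union> B" "R \<noteq> {}" "R \<noteq> A \<union> B"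
    show "\<exists>e\<in>within E (A \<union> B). e \<inter> R \<noteq> {} \<and> e \<inter> (A \<union> B - R) \<noteq> {}"
    proof (cases "R \<inter> A = {} \<or> A \<subseteq> R")
      case False
      then have "R \<inter> A \<subseteq> A" "R \<inter> A \<noteq> {}" "R \<inter> A \<noteq> A" by blast+
      then obtain e where "e \<in> within E A" "e \<inter> (R \<inter> A) \<noteq> {}" "e \<inter> (A - R \<inter> A) \<noteq> {}"
        using trA(1)[unfolded conn_def, rule_format, of "R \<inter> A"] by metis
      then show ?thesis using E_AB by blast
    next
      case True
      define R' where "R' = (R \<inter> B) \<union> (if A \<subseteq> R then {w2} else {})"
      have Ane: "A \<noteq> {}" using trA(2) by auto
      have "R' \<subseteq> insert w2 B" unfolding R'_def by auto
      moreover have "R' \<noteq> {}" using R True unfolding R'_def by (cases "A \<subseteq> R") auto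
      moreover have "R' \<noteq> insert w2 B"
      proof
        assume eq: "R' = insert w2 B"
        then have "A \<subseteq> R" using wB(1) unfolding R'_def by (cases "A \<subseteq> R") auto
        moreover have "B \<subseteq> R" using eq wB(1) unfolding R'_def by (auto split: if_splits)
        ultimately show False using R by blast
      qed
      ultimately obtain e where e: "e \<in> W" "e \<inter> R' \<noteq> {}" "e \<inter> (insert w2 B - R') \<noteq> {}"
        using trB(1)[unfolded conn_def, rule_format, of R'] by metis
      show ?thesis
      proof (cases "e \<in> within E B")
        case True
        then have "e \<subseteq> B" "w2 \<notin> e" using wB unfolding within_def by auto
        then have "e \<inter> R \<noteq> {}" "e \<inter> (A \<union> B - R) \<noteq> {}" using e unfolding R'_def by (auto split: if_splits)
        then show ?thesis using E_AB True by blast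
      next
        case False
        then obtain b where b: "b \<in> N" "e = {b, w2}" using e W by blast
        have bB: "b \<in> B" "b \<noteq> w2" using b wB unfolding N_def by auto
        have "b \<in> R \<longleftrightarrow> \<not> A \<subseteq> R" using e(2,3) b bB wB(1) unfolding R'_def by (auto split: if_splits)
        moreover have "q b \<in> R \<longleftrightarrow> A \<subseteq> R" using True q(1)[OF b(1)] by blast
        ultimately have "{q b, b} \<inter> R \<noteq> {}" "{q b, b} \<inter> (A \<union> B - R) \<noteq> {}"
          using q(1)[OF b(1)] bB(1) by (cases "A \<subseteq> R"; simp)+
        moreover have "{q b, b} \<in> within E (A \<union> B)" using E_AB b(1) by blast
        ultimately show ?thesis by (intro bexI[of _ "{q b, b}"] conjI)
      qed
    qed
  qed
  moreover have "(J1 - {w1}) \<union> J2 \<subseteq> V" using JV d(2) by auto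
  ultimately show ?thesis unfolding decycling_def spanning_tree_def AB(1) by blast
qed

lemma glue_inner_edges:
  assumes V: "sgraph V E" and JV: "J1 \<subseteq> S" "J2 \<subseteq> V - S" and e: "e \<in> within E (J1 \<union> J2)"
  obtains "e \<in> within E J1" | "e \<in> within E J2" |
    a b where "a \<in> J1" "b \<in> J2" "{a, b} \<in> E" "e = {a, b}"
proof -
  have eE: "e \<in> E" "e \<subseteq> J1 \<union> J2" "card e = 2" using e V unfolding within_def sgraph_def by auto
  show ?thesis
  proof (cases "e \<subseteq> J1 \<or> e \<subseteq> J2")
    case True
    then show ?thesis using that(1,2) eE unfolding within_def by blast
  next
    case False
    then obtain a b where ab: "a \<in> e" "a \<in> J1" "b \<in> e" "b \<in> J2" using eE by blast
    have "a \<noteq> b" using ab JV by blast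
    then have "e = {a, b}" using ab eE(3) by (intro card_2_eqI)
    then show ?thesis using that(3) ab eE by blast
  qed
qed

definition flexible :: "'a set \<Rightarrow> 'a set set \<Rightarrow> bool" where
  "flexible V E \<longleftrightarrow> (\<forall>v\<in>V. \<exists>J. v \<in> J \<and> decycling V E J \<and> within E J = {})"

definition coherent :: "'a set \<Rightarrow> 'a set set \<Rightarrow> bool" where
  "coherent V E \<longleftrightarrow> (\<exists>J. decycling V E J \<and> card (within E J) \<le> 1)"

lemma boundary_partner:
  assumes "three_cut V E S" "a \<in> boundary V E S"
  obtains b where "b \<in> boundary V E (V - S)" "{a, b} \<in> E"
proof -
  obtain b where "b \<in> V - S" "{a, b} \<in> E" "a \<in> S" using assms(2) unfolding boundary_def by blast
  then have "b \<in> boundary V E (V - S)"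
    using three_cutD(2)[OF assms(1)] unfolding boundary_def by (auto simp: insert_commute double_diff)
  then show ?thesis using that \<open>{a, b} \<in> E\<close> by blast
qed

lemma boundary_subset: "boundary V E S \<subseteq> S"
  unfolding boundary_def by auto

lemma cap_edge: "u \<in> boundary V E S \<Longrightarrow> {u, w} \<in> cap V E S w"
  unfolding cap_def by auto

lemma flexible_avoid:
  assumes t: "three_cut V E S" and f: "flexible (S \<union> {w}) (cap V E S w)" and b: "b \<in> boundary V E S"
  obtains J where "decycling (S \<union> {w}) (cap V E S w) J" "within (cap V E S w) J = {}" "b \<in> J" "w \<notin> J"
proof -
  have "b \<in> S \<union> {w}" using subsetD[OF boundary_subset b] by simp
  then obtain J where J: "b \<in> J" "decycling (S \<union> {w}) (cap V E S w) J" "within (cap V E S w) J = {}"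
    using f unfolding flexible_def by blast
  have "w \<notin> J"
  proof
    assume "w \<in> J"
    then have "{b, w} \<in> within (cap V E S w) J" using cap_edge[OF b] J(1) unfolding within_def by blast
    then show False using J(3) by blast
  qed
  then show ?thesis using that J by blast
qed

lemma glue_independent:
  assumes t: "three_cut V E S" and w1: "w1 \<notin> S" and w2: "w2 \<notin> V - S"
    and J1: "decycling (S \<union> {w1}) (cap V E S w1) J1" "w1 \<in> J1" "within (cap V E S w1) J1 = {}"
    and J2: "decycling (V - S \<union> {w2}) (cap V E (V - S) w2) J2" "w2 \<notin> J2"
  shows "decycling V E ((J1 - {w1}) \<union> J2)"
    "within E ((J1 - {w1}) \<union> J2) \<subseteq> within (cap V E (V - S) w2) J2"
proof -
  note V = cubic3D(1)[OF three_cutD(1)[OF t]]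
  have no: "a \<notin> J1" if ab: "a \<in> S" "b \<in> V - S" "{a, b} \<in> E" for a b
  proof
    assume "a \<in> J1"
    have "a \<in> boundary V E S" using ab unfolding boundary_def by blast
    then have "{a, w1} \<in> within (cap V E S w1) J1"
      using cap_edge J1(2) \<open>a \<in> J1\<close> unfolding within_def by fastforce
    then show False using J1(3) by blast
  qed
  show "decycling V E ((J1 - {w1}) \<union> J2)"
    by (rule decycling_glue[OF t w1 w2 J1(1,2) J2]) (use no in blast)
  have JV: "J1 - {w1} \<subseteq> S" "J2 \<subseteq> V - S" using J1(1) J2 unfolding decycling_def by auto
  have c1: "within E (J1 - {w1}) \<subseteq> within (cap V E S w1) J1"
    using JV(1) unfolding cap_def within_def by auto
  have c2: "within E J2 = within (cap V E (V - S) w2) J2" using cap_within[OF J2(2) JV(2)] by simp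
  show "within E ((J1 - {w1}) \<union> J2) \<subseteq> within (cap V E (V - S) w2) J2"
  proof
    fix e assume e: "e \<in> within E ((J1 - {w1}) \<union> J2)"
    show "e \<in> within (cap V E (V - S) w2) J2"
    proof (cases rule: glue_inner_edges[OF V JV e])
      case 1
      then show ?thesis using subsetD[OF c1 1] J1(3) by simp
    next
      case 2
      then show ?thesis using c2 by blast
    next
      case (3 a b)
      then show ?thesis using no[of a b] JV by blast
    qed
  qed
qed

lemma flexible_glue_half:
  assumes t: "three_cut V E S" and w1: "w1 \<notin> S" and w2: "w2 \<notin> V - S"
    and f1: "flexible (S \<union> {w1}) (cap V E S w1)" and f2: "flexible (V - S \<union> {w2}) (cap V E (V - S) w2)"
    and v: "v \<in> S"
  shows "\<exists>J. v \<in> J \<and> decycling V E J \<and> within E J = {}"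
proof -
  note t' = three_cut_sym[OF t]
  have SS: "V - (V - S) = S" using three_cutD(2)[OF t] by auto
  obtain J1 where J1: "v \<in> J1" "decycling (S \<union> {w1}) (cap V E S w1) J1" "within (cap V E S w1) J1 = {}"
    using f1 v unfolding flexible_def by blast
  show ?thesis
  proof (cases "w1 \<in> J1")
    case True
    have "boundary V E (V - S) \<noteq> {}" using card_boundary[OF t'] by auto
    then obtain b where b: "b \<in> boundary V E (V - S)" by blast
    obtain J2 where J2: "decycling (V - S \<union> {w2}) (cap V E (V - S) w2) J2"
      "within (cap V E (V - S) w2) J2 = {}" "w2 \<notin> J2"
      using flexible_avoid[OF t' f2 b] by blast
    have "v \<noteq> w1" using v w1 by auto
    then show ?thesis
      using glue_independent[OF t w1 w2 J1(2) True J1(3) J2(1,3)] J2(2) J1(1)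
      by (intro exI[of _ "(J1 - {w1}) \<union> J2"]) auto
  next
    case False
    obtain J2 where J2: "w2 \<in> J2" "decycling (V - S \<union> {w2}) (cap V E (V - S) w2) J2"
      "within (cap V E (V - S) w2) J2 = {}"
      using f2 unfolding flexible_def by blast
    have w1': "w1 \<notin> V - (V - S)" using w1 SS by simp
    show ?thesis
      using glue_independent[OF t' w2 w1' J2(2,1,3), unfolded SS, OF J1(2) False] J1(1,3)
      by (intro exI[of _ "(J2 - {w2}) \<union> J1"]) auto
  qed
qed

lemma flexible_glue:
  assumes t: "three_cut V E S" and w1: "w1 \<notin> S" and w2: "w2 \<notin> V - S"
    and f1: "flexible (S \<union> {w1}) (cap V E S w1)" and f2: "flexible (V - S \<union> {w2}) (cap V E (V - S) w2)"
  shows "flexible V E"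
  unfolding flexible_def
proof
  fix v assume "v \<in> V"
  have SS: "V - (V - S) = S" using three_cutD(2)[OF t] by auto
  show "\<exists>J. v \<in> J \<and> decycling V E J \<and> within E J = {}"
  proof (cases "v \<in> S")
    case True
    then show ?thesis by (rule flexible_glue_half[OF t w1 w2 f1 f2])
  next
    case False
    then have "v \<in> V - S" using \<open>v \<in> V\<close> by simp
    then show ?thesis
      using flexible_glue_half[OF three_cut_sym[OF t] w2, unfolded SS, OF w1 f2 f1] by blast
  qed
qed

text \<open>If \<open>w1\<close> and its neighbour \<open>a\<close> form the edge inside \<open>J1\<close>, the partner \<open>b\<close> of \<open>a\<close> across the cut is
  put into \<open>J2\<close>, so that the edge \<open>ab\<close> takes the place of \<open>w1a\<close>.\<close>

lemma coherent_glue: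
  assumes t: "three_cut V E S" and w1: "w1 \<notin> S" and w2: "w2 \<notin> V - S"
    and f1: "coherent (S \<union> {w1}) (cap V E S w1)" and f2: "flexible (V - S \<union> {w2}) (cap V E (V - S) w2)"
  shows "coherent V E"
proof -
  note t' = three_cut_sym[OF t]
  note V = cubic3D(1)[OF three_cutD(1)[OF t]]
  have SS: "V - (V - S) = S" using three_cutD(2)[OF t] by auto
  obtain J1 where J1: "decycling (S \<union> {w1}) (cap V E S w1) J1" "card (within (cap V E S w1) J1) \<le> 1"
    using f1 unfolding coherent_def by blast
  have finC: "finite (cap V E S w1)"
    using sgraph_finite[OF cubic3D(1)[OF cubic3_cap[OF t w1]]] by blast
  then have finW: "finite (within (cap V E S w1) J1)" by simp
  have uniq: "e = f" if "e \<in> within (cap V E S w1) J1" "f \<in> within (cap V E S w1) J1" for e f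
    using J1(2) finW that by (metis One_nat_def card_le_Suc0_iff_eq)
  show ?thesis
  proof (cases "w1 \<in> J1")
    case False
    obtain J2 where J2: "w2 \<in> J2" "decycling (V - S \<union> {w2}) (cap V E (V - S) w2) J2"
      "within (cap V E (V - S) w2) J2 = {}"
      using f2 unfolding flexible_def by blast
    have w1': "w1 \<notin> V - (V - S)" using w1 SS by simp
    note g = glue_independent[OF t' w2 w1' J2(2,1,3), unfolded SS, OF J1(1) False]
    have "card (within E ((J2 - {w2}) \<union> J1)) \<le> card (within (cap V E S w1) J1)"
      by (rule card_mono[OF finW g(2)])
    then show ?thesis using g(1) J1(2) unfolding coherent_def by (metis le_trans)
  next
    case True
    have bne: "boundary V E S \<noteq> {}" using card_boundary[OF t] by auto
    obtain a where a: "a \<in> boundary V E S" "boundary V E S \<inter> J1 \<subseteq> {a}"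
    proof (cases "boundary V E S \<inter> J1 = {}")
      case True
      then show ?thesis using that bne by blast
    next
      case False
      then obtain a where a: "a \<in> boundary V E S" "a \<in> J1" by blast
      have "a' = a" if a': "a' \<in> boundary V E S" "a' \<in> J1" for a'
      proof -
        have "{a, w1} = {a', w1}"
          by (rule uniq) (use a a' True cap_edge[of _ V E S w1] in \<open>auto simp: within_def\<close>)
        then show ?thesis by (metis doubleton_eq_iff)
      qed
      then show ?thesis using that a by blast
    qed
    obtain b where b: "b \<in> boundary V E (V - S)" "{a, b} \<in> E" using boundary_partner[OF t a(1)] .
    have aS: "a \<in> S" and bS: "b \<in> V - S"
      using subsetD[OF boundary_subset a(1)] subsetD[OF boundary_subset b(1)] .
    obtain J2 where J2: "decycling (V - S \<union> {w2}) (cap V E (V - S) w2) J2"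
      "within (cap V E (V - S) w2) J2 = {}" "b \<in> J2" "w2 \<notin> J2"
      using flexible_avoid[OF t' f2 b(1)] .
    have cut: "x = a \<and> y = b" if xy: "x \<in> S" "y \<in> V - S" "{x, y} \<in> E" "x \<in> J1" for x y
    proof -
      have "x = a" using a(2) xy unfolding boundary_def by blast
      then show ?thesis using three_cut_unique[OF t aS, of y b] xy bS b(2) by simp
    qed
    have dec: "decycling V E ((J1 - {w1}) \<union> J2)"
      by (rule decycling_glue[OF t w1 w2 J1(1) True J2(1,4)]) (use cut J2(3) in blast)
    have JV: "J1 - {w1} \<subseteq> S" "J2 \<subseteq> V - S" using J1(1) J2(1,4) unfolding decycling_def by auto
    have c1: "within E (J1 - {w1}) \<subseteq> within (cap V E S w1) J1"
      using JV(1) unfolding cap_def within_def by auto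
    have c2: "within E J2 = {}" using cap_within[OF J2(4) JV(2)] J2(2) by simp
    have edges: "e \<in> within E (J1 - {w1}) \<or> e = {a, b} \<and> a \<in> J1" if e: "e \<in> within E ((J1 - {w1}) \<union> J2)" for e
    proof (cases rule: glue_inner_edges[OF V JV e])
      case 2
      then show ?thesis using c2 by blast
    next
      case (3 x y)
      then have "x \<in> S" "y \<in> V - S" "x \<in> J1" using JV by auto
      then show ?thesis using cut[of x y] 3 by blast
    qed blast
    have "e = f" if ef: "e \<in> within E ((J1 - {w1}) \<union> J2)" "f \<in> within E ((J1 - {w1}) \<union> J2)" for e f
    proof (cases "a \<in> J1")
      case False
      then show ?thesis using edges[OF ef(1)] edges[OF ef(2)] c1 uniq by blast
    next
      case aJ: True
      have "{a, w1} \<in> within (cap V E S w1) J1" using cap_edge[OF a(1)] aJ True unfolding within_def by blast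
      then have "within E (J1 - {w1}) \<subseteq> {{a, w1}}" using c1 uniq by blast
      moreover have "{a, w1} \<notin> within E (J1 - {w1})" unfolding within_def by blast
      ultimately have "within E (J1 - {w1}) = {}" by blast
      then show ?thesis using edges[OF ef(1)] edges[OF ef(2)] by blast
    qed
    then have "card (within E ((J1 - {w1}) \<union> J2)) \<le> 1"
      using sgraph_finite[OF V] by (metis One_nat_def card_le_Suc0_iff_eq finite_within)
    then show ?thesis using dec unfolding coherent_def by blast
  qed
qed

section \<open>Cycles, connectedness and the canonical decomposition\<close>

lemma card_edges_within_ge:
  assumes V: "sgraph V E" and cn: "conn V E" and S: "S \<subseteq> V" "S \<noteq> {}"
  shows "card (within E S) + card V \<le> card E + card S"
  using S
proof (induction "card (V - S)" arbitrary: S)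
  case 0
  then have "S = V" using sgraph_finite[OF V] by auto
  then show ?case using within_whole[OF V] by simp
next
  case (Suc n)
  note fin = sgraph_finite[OF V]
  have finS: "finite S" using Suc.prems fin finite_subset by blast
  have "S \<noteq> V" using Suc.hyps(2) by auto
  then obtain e where e: "e \<in> E" "e \<inter> S \<noteq> {}" "e \<inter> (V - S) \<noteq> {}"
    using cn[unfolded conn_def, rule_format, of S] Suc.prems by metis
  obtain x y where xy: "x \<in> e" "x \<in> S" "y \<in> e" "y \<in> V - S" using e by blast
  have "e = {x, y}" using e(1) V xy by (intro card_2_eqI) (auto simp: sgraph_def)
  let ?S = "insert y S"
  have "V - ?S = V - S - {y}" by blast
  then have "card (V - ?S) = n" using Suc.hyps(2) xy fin by simp
  then have "card (within E ?S) + card V \<le> card E + card ?S"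
    using Suc.hyps(1)[of ?S] Suc.prems xy by simp
  moreover have "card ?S = card S + 1" using xy finS by simp
  moreover have "insert e (within E S) \<subseteq> within E ?S" "e \<notin> within E S"
    using xy e(1) \<open>e = {x, y}\<close> unfolding within_def by auto
  then have "card (within E S) + 1 \<le> card (within E ?S)"
    using card_mono[of "within E ?S" "insert e (within E S)"] fin by simp
  ultimately show ?case by linarith
qed

lemma connected_if_conn:
  assumes "conn V E" "V \<noteq> {}" "sgraph V E"
  shows "connected (V, E)"
  unfolding connected_def
proof (intro conjI ballI)
  show "verts (V, E) \<noteq> {}" using assms by (simp add: verts_def)
  fix u v assume uv: "u \<in> verts (V, E)" "v \<in> verts (V, E)"
  let ?S = "{x \<in> V. (adj (V, E))\<^sup>*\<^sup>* u x}"
  have "?S = V"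
  proof (rule ccontr)
    assume "?S \<noteq> V"
    moreover have "?S \<noteq> {}" using uv by (auto simp: verts_def)
    ultimately obtain e where e: "e \<in> E" "e \<inter> ?S \<noteq> {}" "e \<inter> (V - ?S) \<noteq> {}"
      using assms(1)[unfolded conn_def, rule_format, of ?S] by auto
    then obtain x y where xy: "x \<in> e" "x \<in> ?S" "y \<in> e" "y \<in> V" "y \<notin> ?S" by blast
    have "e = {x, y}" using e(1) assms(3) xy by (intro card_2_eqI) (auto simp: sgraph_def)
    then have "adj (V, E) x y" using e(1) by (simp add: adj_def edges_def)
    then have "(adj (V, E))\<^sup>*\<^sup>* u y" using xy(2) by (auto intro: rtranclp.rtrancl_into_rtrancl)
    then show False using xy by simp
  qed
  then show "(adj (V, E))\<^sup>*\<^sup>* u v" using uv by (auto simp: verts_def)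
qed

lemma cycle_edges:
  assumes "is_cycle (V, E) c" "sgraph V E"
  shows "card (set c) \<le> card (within E (set c))" "set c \<subseteq> V" "set c \<noteq> {}"
proof -
  define k where "k = length c"
  have k: "k \<ge> 3" "distinct c" and cV: "set c \<subseteq> V" and step: "\<And>i. Suc i < k \<Longrightarrow> {c ! i, c ! Suc i} \<in> E"
    and last: "{last c, hd c} \<in> E"
    using assms(1) unfolding is_cycle_def k_def adj_def verts_def edges_def by auto
  show "set c \<subseteq> V" by (rule cV)
  show "set c \<noteq> {}" using k unfolding k_def by auto
  define g where "g i = {c ! i, c ! (Suc i mod k)}" for i
  have ne: "c \<noteq> []" using k unfolding k_def by auto
  have gE: "g i \<in> within E (set c)" if "i < k" for i
  proof (cases "Suc i < k")
    case True
    then show ?thesis using step[of i] that unfolding g_def within_def k_def by simp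
  next
    case False
    then have "Suc i = k" using that by simp
    then have "g i = {last c, hd c}"
      using ne \<open>Suc i = k\<close>[symmetric] unfolding g_def k_def by (simp add: last_conv_nth hd_conv_nth)
    then show ?thesis using last ne unfolding within_def by simp
  qed
  have "inj_on g {..<k}"
  proof (rule inj_onI)
    fix i j assume ij: "i \<in> {..<k}" "j \<in> {..<k}" "g i = g j"
    show "i = j"
    proof (rule ccontr)
      assume "i \<noteq> j"
      have lt: "i < k" "j < k" "Suc i mod k < k" "Suc j mod k < k" using ij k by auto
      have inj: "c ! a = c ! b \<longleftrightarrow> a = b" if "a < k" "b < k" for a b
        using that k(2) unfolding k_def by (simp add: nth_eq_iff_index_eq)
      have m: "Suc a mod k = (if Suc a = k then 0 else Suc a)" if "a < k" for a
        using that by auto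
      have "i = Suc j mod k \<and> j = Suc i mod k"
        using ij(3) \<open>i \<noteq> j\<close> inj lt unfolding g_def doubleton_eq_iff by metis
      then have "Suc j = k \<and> i = 0 \<or> i = Suc j" "Suc i = k \<and> j = 0 \<or> j = Suc i"
        using m lt by metis+
      then show False using k(1) by (elim disjE conjE) linarith+
    qed
  qed
  then have "card (g ` {..<k}) = k" by (simp add: card_image)
  moreover have "g ` {..<k} \<subseteq> within E (set c)" using gE by auto
  moreover have "card (set c) = k" using k(2) unfolding k_def by (rule distinct_card)
  ultimately show "card (set c) \<le> card (within E (set c))"
    using card_mono[of "within E (set c)" "g ` {..<k}"] sgraph_finite[OF assms(2)] by simp
qed

lemma tree_if_spanning_tree:
  assumes "sgraph V E" "spanning_tree V E"
  shows "tree (V, E)"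
proof -
  have cn: "conn V E" "card E + 1 = card V" using assms(2) unfolding spanning_tree_def by auto
  then have "V \<noteq> {}" by auto
  have "\<not> is_cycle (V, E) c" for c
  proof
    assume c: "is_cycle (V, E) c"
    note ce = cycle_edges[OF c assms(1)]
    show False using card_edges_within_ge[OF assms(1) cn(1) ce(2,3)] ce(1) cn(2) by linarith
  qed
  then show ?thesis
    unfolding tree_def has_cycle_def using connected_if_conn[OF cn(1) \<open>V \<noteq> {}\<close> assms(1)] by blast
qed

lemma induced_eq: "A \<subseteq> verts G \<Longrightarrow> induced G A = (A, within (edges G) A)"
  unfolding induced_def within_def by auto

lemma coherent_decycling_if_coherent:
  assumes V: "sgraph (verts G) (edges G)" and "coherent (verts G) (edges G)"
  shows "\<exists>A J. coherent_decycling_partition G A J"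
proof -
  obtain J where J: "J \<subseteq> verts G" "spanning_tree (verts G - J) (within (edges G) (verts G - J))"
    "card (within (edges G) J) \<le> 1"
    using assms(2) unfolding coherent_def decycling_def by blast
  have fin: "finite (within (edges G) J)" using sgraph_finite[OF V] by simp
  have "tree (induced G (verts G - J))"
    unfolding induced_eq[OF Diff_subset]
    by (rule tree_if_spanning_tree[OF sgraph_within[OF V Diff_subset] J(2)])
  moreover have "edges (induced G J) = within (edges G) J" using induced_eq[OF J(1)] by (simp add: edges_def)
  then have "independent G J \<or> near_independent G J"
    unfolding independent_def near_independent_def using J(3) fin by (auto simp: le_Suc_eq)
  ultimately have "coherent_decycling_partition G (verts G - J) J"
    unfolding coherent_decycling_partition_def using J(1) by auto
  then show ?thesis by blast
qed

lemma cut_edges_eq: "cut_edges G S = cut_between (edges G) S (verts G - S)"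
  unfolding cut_edges_def cut_between_def ..

lemma attach_eq: "verts (attach G S w) = S \<union> {w}" "edges (attach G S w) = cap (verts G) (edges G) S w"
  unfolding attach_def cap_def within_def boundary_def verts_def edges_def by auto

lemma conn_3cut_side:
  assumes V: "cubic3 V E" and S: "S \<subseteq> V" "3 * card S = 2 * card (within E S) + 3"
  shows "conn S (within E S)"
  unfolding conn_def
proof (intro allI impI, rule ccontr)
  note c = cubic3D[OF V] note fin = sgraph_finite[OF c(1)]
  fix R assume R: "R \<subseteq> S" "R \<noteq> {}" "R \<noteq> S" "\<not> (\<exists>e\<in>within E S. e \<inter> R \<noteq> {} \<and> e \<inter> (S - R) \<noteq> {})"
  have "within E S \<subseteq> within E R \<union> within E (S - R)" using R unfolding within_def by blast
  then have "card (within E S) \<le> card (within E R \<union> within E (S - R))" using fin by (intro card_mono) auto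
  also have "\<dots> \<le> card (within E R) + card (within E (S - R))" by (rule card_Un_le)
  finally have "card (within E S) \<le> card (within E R) + card (within E (S - R))" .
  moreover have "R \<noteq> V" "S - R \<noteq> V" "R \<subseteq> V" "S - R \<subseteq> V" "S - R \<noteq> {}" using R S by blast+
  then have "2 * card (within E R) + 3 \<le> 3 * card R" "2 * card (within E (S - R)) + 3 \<le> 3 * card (S - R)"
    using c(4)[of R] c(4)[of "S - R"] R(2) by blast+
  moreover have "finite S" using S fin finite_subset by blast
  then have "card S = card R + card (S - R)" using R by (metis card_Diff_subset card_mono finite_subset le_add_diff_inverse)
  ultimately show False using S(2) by linarith
qed

lemma no_3cut_if:
  assumes V: "cubic3 (verts G) (edges G)" and "\<nexists>S. nontrivial_3cut G S"
  shows "no_3cut (verts G) (edges G)"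
  unfolding no_3cut_def
proof (intro allI impI, rule ccontr)
  note c = cubic3D[OF V] note fin = sgraph_finite[OF c(1)]
  fix S assume S: "S \<subseteq> verts G" "2 \<le> card S" "card S + 2 \<le> card (verts G)"
    "\<not> 2 * card (within (edges G) S) + 4 \<le> 3 * card S"
  let ?R = "verts G - S"
  have finS: "finite S" using S fin finite_subset by blast
  then have cR: "card ?R + card S = card (verts G)" using S fin by (simp add: card_Diff_subset card_mono)
  then have "card ?R \<ge> 2" using S(3) by linarith
  then have ne: "S \<noteq> {}" "S \<noteq> verts G" "?R \<noteq> {}" using S(2) by (metis card.empty not_numeral_le_zero Diff_cancel)+
  then have eqS: "3 * card S = 2 * card (within (edges G) S) + 3" using c(4)[OF S(1)] S(4) by linarith
  have cs: "card (cut_between (edges G) S ?R) = 3" using cut_count[OF c(1,3) S(1)] eqS by simp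
  have "cut_between (edges G) ?R (verts G - ?R) = cut_between (edges G) S ?R"
    using S(1) by (auto simp: cut_between_def double_diff)
  then have eqR: "3 * card ?R = 2 * card (within (edges G) ?R) + 3"
    using cut_count[OF c(1,3) Diff_subset, of S] cs by simp
  have "connected (induced G S)" unfolding induced_eq[OF S(1)]
    by (rule connected_if_conn[OF conn_3cut_side[OF V S(1) eqS] ne(1) sgraph_within[OF c(1) S(1)]])
  moreover have "connected (induced G ?R)" unfolding induced_eq[OF Diff_subset]
    by (rule connected_if_conn[OF conn_3cut_side[OF V Diff_subset eqR] ne(3) sgraph_within[OF c(1) Diff_subset]])
  ultimately have "nontrivial_3cut G S"
    unfolding nontrivial_3cut_def cut_edges_eq using S cs cR by auto
  then show False using assms(2) by blast
qed

lemma cyclically_odd_iff: "cyclically_odd G \<longleftrightarrow> even (card (edges G) + card (verts G))"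
  unfolding cyclically_odd_def beta_def by auto

lemma coherent_if_flexible: "flexible V E \<Longrightarrow> V \<noteq> {} \<Longrightarrow> coherent V E"
  unfolding flexible_def coherent_def by fastforce

lemma canon_decomp_decycling:
  assumes "canon_decomp G F" "cubic3 (verts G) (edges G)"
  shows "(filter cyclically_odd F = [] \<longrightarrow> flexible (verts G) (edges G)) \<and>
    (length (filter cyclically_odd F) \<le> 1 \<longrightarrow> coherent (verts G) (edges G))"
  using assms
proof (induction rule: canon_decomp.induct)
  case (stop G)
  note nc = no_3cut_if[OF stop.prems stop.hyps]
  have "flexible (verts G) (edges G)" if "\<not> cyclically_odd G"
    unfolding flexible_def using even_decycling[OF stop.prems nc] that by (simp add: cyclically_odd_iff)
  moreover have "coherent (verts G) (edges G)" if "cyclically_odd G"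
    unfolding coherent_def using odd_decycling[OF stop.prems nc] that by (simp add: cyclically_odd_iff)
  ultimately show ?case using coherent_if_flexible cubic3D(2)[OF stop.prems] by auto
next
  case (split G S w1 w2 F1 F2)
  let ?V = "verts G" and ?E = "edges G"
  have t: "three_cut ?V ?E S"
    using split.hyps(1) split.prems unfolding three_cut_def nontrivial_3cut_def cut_edges_eq by simp
  note t' = three_cut_sym[OF t]
  have SS: "?V - (?V - S) = S" using three_cutD(2)[OF t] by auto
  note w = split.hyps(2,3)
  have "cubic3 (verts (attach G S w1)) (edges (attach G S w1))"
    unfolding attach_eq by (rule cubic3_cap[OF t w(1)])
  note IH1 = split.IH(1)[OF this, unfolded attach_eq]
  have "cubic3 (verts (attach G (?V - S) w2)) (edges (attach G (?V - S) w2))"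
    unfolding attach_eq by (rule cubic3_cap[OF t' w(2)])
  note IH2 = split.IH(2)[OF this, unfolded attach_eq]
  show ?case
  proof (intro conjI impI)
    assume "filter cyclically_odd (F1 @ F2) = []"
    then show "flexible ?V ?E" using IH1 IH2 flexible_glue[OF t w] by simp
  next
    assume "length (filter cyclically_odd (F1 @ F2)) \<le> 1"
    then have "length (filter cyclically_odd F1) \<le> 1 \<and> filter cyclically_odd F2 = [] \<or>
        filter cyclically_odd F1 = [] \<and> length (filter cyclically_odd F2) \<le> 1"
      by (cases "filter cyclically_odd F1"; cases "filter cyclically_odd F2") auto
    then show "coherent ?V ?E"
    proof (elim disjE conjE)
      assume "length (filter cyclically_odd F1) \<le> 1" "filter cyclically_odd F2 = []"
      then show ?thesis using IH1 IH2 coherent_glue[OF t w] by blast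
    next
      assume "filter cyclically_odd F1 = []" "length (filter cyclically_odd F2) \<le> 1"
      then show ?thesis using IH1 IH2 coherent_glue[OF t' w(2), unfolded SS, OF w(1)] by blast
    qed
  qed
qed

lemma cubic3_if_3_connected:
  assumes "cubic G" "k_connected 3 G"
  shows "cubic3 (verts G) (edges G)"
proof -
  let ?V = "verts G" and ?E = "edges G"
  have wf: "finite ?V" "\<And>e. e \<in> ?E \<Longrightarrow> \<exists>u v. e = {u, v} \<and> u \<noteq> v \<and> u \<in> ?V \<and> v \<in> ?V"
    using assms(1) unfolding cubic_def wf_graph_def by auto
  have sg: "sgraph ?V ?E" unfolding sgraph_def using wf by fastforce
  have deg: "card {e \<in> ?E. v \<in> e} = 3" if "v \<in> ?V" for v
    using assms(1) that unfolding cubic_def degree_def by simp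
  have "card ?V > 3" using assms(2) unfolding k_connected_def by simp
  then have "?V \<noteq> {}" by auto
  moreover have "2 * card (within ?E S) + 3 \<le> 3 * card S" if S: "S \<subseteq> ?V" "S \<noteq> {}" "S \<noteq> ?V" for S
  proof (rule ccontr)
    assume neg: "\<not> ?thesis"
    then have c2: "card (cut_between ?E S (?V - S)) \<le> 2" using cut_count[OF sg deg S(1)] by simp
    let ?C = "cut_between ?E S (?V - S)"
    have finS: "finite S" using S wf finite_subset by blast
    have finC: "finite ?C" using sgraph_finite[OF sg] unfolding cut_between_def by simp
    define U where "U = {u \<in> S. \<exists>e\<in>?C. u \<in> e}"
    have "\<exists>f. \<forall>e\<in>?C. e \<inter> S = {f e}"
    proof -
      have "\<exists>u. e \<inter> S = {u}" if e: "e \<in> ?C" for e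
      proof -
        have eE: "e \<in> ?E" "e \<inter> S \<noteq> {}" "e \<inter> (?V - S) \<noteq> {}" using e unfolding cut_between_def by auto
        obtain u v where "e = {u, v}" using wf(2)[OF eE(1)] by blast
        then show ?thesis using eE by (cases "u \<in> S"; cases "v \<in> S") auto
      qed
      then show ?thesis by metis
    qed
    then obtain f where f: "\<And>e. e \<in> ?C \<Longrightarrow> e \<inter> S = {f e}" by blast
    have "U \<subseteq> f ` ?C" using f unfolding U_def by fastforce
    then have "card U \<le> card (f ` ?C)" using finC by (intro card_mono) auto
    then have cU: "card U \<le> 2" using card_image_le[OF finC, of f] c2 by linarith
    have US: "U \<subseteq> S" unfolding U_def by auto
    have "U \<noteq> S"
    proof
      assume "U = S"
      then have "card S \<le> 2" using cU by simp
      moreover have "card S \<noteq> 0" using S finS by simp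
      ultimately consider "card S = 1" | "card S = 2" by linarith
      then show False
      proof cases
        case 1
        then obtain x where "S = {x}" by (metis card_1_singletonE)
        then show False using within_single[OF sg, of x] neg by simp
      next
        case 2
        have "within ?E S \<subseteq> {S}"
        proof
          fix e assume "e \<in> within ?E S"
          then have "e \<subseteq> S" "card e = 2" using sg unfolding within_def sgraph_def by auto
          then show "e \<in> {S}" using finS 2 by (simp add: card_subset_eq)
        qed
        then have "card (within ?E S) \<le> 1" using card_mono[of "{S}" "within ?E S"] by simp
        then show False using neg 2 by simp
      qed
    qed
    then obtain x where x: "x \<in> S" "x \<notin> U" using US by blast
    obtain y where y: "y \<in> ?V" "y \<notin> S" using S by blast
    have "U \<subseteq> ?V" using US S by blast
    then have "connected (del_verts G U)" using assms(2) cU unfolding k_connected_def by simp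
    moreover have dv: "del_verts G U = (?V - U, within ?E (?V - U))"
      unfolding del_verts_def by (rule induced_eq) auto
    moreover have "x \<in> ?V - U" "y \<in> ?V - U" using x y US S by auto
    ultimately have r: "(adj (?V - U, within ?E (?V - U)))\<^sup>*\<^sup>* x y"
      unfolding connected_def by (simp add: verts_def)
    have "z \<in> S - U" if "(adj (?V - U, within ?E (?V - U)))\<^sup>*\<^sup>* x z" for z
      using that
    proof (induction rule: rtranclp_induct)
      case base
      then show ?case using x by simp
    next
      case (step a b)
      then have e: "{a, b} \<in> ?E" "{a, b} \<subseteq> ?V - U" unfolding adj_def edges_def within_def by auto
      have "b \<in> S"
      proof (rule ccontr)
        assume "b \<notin> S"
        then have "{a, b} \<in> ?C" using e step.IH unfolding cut_between_def by auto
        then have "a \<in> U" using step.IH unfolding U_def by auto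
        then show False using step.IH by simp
      qed
      then show ?case using e by simp
    qed
    then show False using r y by blast
  qed
  ultimately show ?thesis using sg deg unfolding cubic3_def by simp
qed

theorem theorem15:
  fixes G :: "'a graph"
  assumes "cubic G"
    and "k_connected 3 G"
    and "\<exists>F. canon_decomp G F \<and> length (filter cyclically_odd F) \<le> 1"
  shows "\<exists>A J. coherent_decycling_partition G A J"
proof -
  have V: "cubic3 (verts G) (edges G)" by (rule cubic3_if_3_connected[OF assms(1,2)])
  then have "coherent (verts G) (edges G)" using assms(3) canon_decomp_decycling by blast
  then show ?thesis by (rule coherent_decycling_if_coherent[OF cubic3D(1)[OF V]])
qed

end
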